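(* Let $G$ be an infinite group and let $X$ be a non-trivial strongly irreducible $G$-subshift. Then every finite group embeds into $\operatorname{Aut}(X)$.
   Context: Let $A$ be a finite alphabet and $G$ a group. $A^G$ carries the prodiscrete topology and the left shift action $(gx)(h)=x(g^{-1}h)$. A $G$-subshift is a closed, shift-invariant subset $X\subset A^G$; it is non-trivial if it is neither empty nor a single point. For finite $F\subset G$, $L_F(X)=\{x|_F : x\in X\}$. $X$ is strongly irreducible if there is a finite $K\subset G$ such that whenever $S,T\subset G$ are finite with $SK\cap T=\varnothing$, for every $p\in L_S(X)$ and $q\in L_T(X)$ there is $x\in X$ with $x|_S=p$ and $x|_T=q$. $\operatorname{Aut}(X)$ is the group of all $G$-equivariant homeomorphisms $X\to X$ under composition. *)

theory Defs
  imports "HOL-Analysis.Analysis" "HOL-Algebra.Bij" "HOL-Algebra.Coset"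
begin

text \<open>
  The group is a \<^term>\<open>group G\<close> on an explicit carrier and the alphabet a set \<open>A\<close>. A configuration
  is an element of \<open>carrier G \<rightarrow>\<^sub>E A\<close>, which is the underlying set of the product topology below;
  likewise a pattern on \<open>F\<close> is a function that is \<open>undefined\<close> outside \<open>F\<close>.
\<close>

definition prodiscrete :: "('g, 'm) monoid_scheme \<Rightarrow> 'a set \<Rightarrow> ('g \<Rightarrow> 'a) topology" where
  "prodiscrete G A = product_topology (\<lambda>_. discrete_topology A) (carrier G)"

definition shift :: "('g, 'm) monoid_scheme \<Rightarrow> 'g \<Rightarrow> ('g \<Rightarrow> 'a) \<Rightarrow> 'g \<Rightarrow> 'a" where
  "shift G g x = (\<lambda>h \<in> carrier G. x (inv\<^bsub>G\<^esub> g \<otimes>\<^bsub>G\<^esub> h))"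

definition subshift :: "('g, 'm) monoid_scheme \<Rightarrow> 'a set \<Rightarrow> ('g \<Rightarrow> 'a) set \<Rightarrow> bool" where
  "subshift G A X \<longleftrightarrow>
     closedin (prodiscrete G A) X \<and> (\<forall>g \<in> carrier G. shift G g ` X \<subseteq> X)"

definition nontrivial_subshift :: "('g \<Rightarrow> 'a) set \<Rightarrow> bool" where
  "nontrivial_subshift X \<longleftrightarrow> X \<noteq> {} \<and> \<not> (\<exists>x. X = {x})"

definition patterns :: "('g \<Rightarrow> 'a) set \<Rightarrow> 'g set \<Rightarrow> ('g \<Rightarrow> 'a) set" where
  "patterns X F = (\<lambda>x. restrict x F) ` X"

definition strongly_irreducible ::
  "('g, 'm) monoid_scheme \<Rightarrow> ('g \<Rightarrow> 'a) set \<Rightarrow> bool" where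
  "strongly_irreducible G X \<longleftrightarrow>
     (\<exists>K. finite K \<and> K \<subseteq> carrier G \<and>
       (\<forall>S T. finite S \<and> S \<subseteq> carrier G \<and> finite T \<and> T \<subseteq> carrier G \<and>
          (S <#>\<^bsub>G\<^esub> K) \<inter> T = {} \<longrightarrow>
          (\<forall>p \<in> patterns X S. \<forall>q \<in> patterns X T.
             \<exists>x \<in> X. restrict x S = p \<and> restrict x T = q)))"

text \<open>
  As with \<^const>\<open>AutoGroup\<close>, maps \<open>X \<rightarrow> X\<close> are taken to be extensional, so that equality of
  elements of the group is equality of maps on \<open>X\<close>.
\<close>

definition subshift_auts ::
  "('g, 'm) monoid_scheme \<Rightarrow> 'a set \<Rightarrow> ('g \<Rightarrow> 'a) set \<Rightarrow> (('g \<Rightarrow> 'a) \<Rightarrow> ('g \<Rightarrow> 'a)) set" where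
  "subshift_auts G A X =
     {f \<in> Bij X.
        homeomorphic_map (subtopology (prodiscrete G A) X) (subtopology (prodiscrete G A) X) f \<and>
        (\<forall>g \<in> carrier G. \<forall>x \<in> X. f (shift G g x) = shift G g (f x))}"

definition Aut_subshift ::
  "('g, 'm) monoid_scheme \<Rightarrow> 'a set \<Rightarrow> ('g \<Rightarrow> 'a) set \<Rightarrow> (('g \<Rightarrow> 'a) \<Rightarrow> ('g \<Rightarrow> 'a)) monoid" where
  "Aut_subshift G A X = BijGroup X \<lparr>carrier := subshift_auts G A X\<rparr>"

lemma group_Aut_subshift:
  assumes "subshift G A X"
  shows "group (Aut_subshift G A X)"
proof -
  let ?T = "subtopology (prodiscrete G A) X"
  have top: "topspace ?T = X"
    using assms closedin_subset[of "prodiscrete G A" X] by (auto simp: subshift_def)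
  have inv: "shift G g x \<in> X" if "g \<in> carrier G" "x \<in> X" for g x
    using assms that by (auto simp: subshift_def)
  have "subgroup (subshift_auts G A X) (BijGroup X)"
  proof (rule subgroup.intro)
    show "subshift_auts G A X \<subseteq> carrier (BijGroup X)"
      by (auto simp: subshift_auts_def BijGroup_def)
  next
    fix f f' assume f: "f \<in> subshift_auts G A X" and f': "f' \<in> subshift_auts G A X"
    have B: "f \<in> Bij X" "f' \<in> Bij X"
      using f f' by (auto simp: subshift_auts_def)
    have mem: "f' x \<in> X" if "x \<in> X" for x
      using B(2) that Bij_imp_funcset by blast
    have "homeomorphic_map ?T ?T (f \<circ> f')"
      using f f' by (auto simp: subshift_auts_def intro: homeomorphic_map_compose)
    then have "homeomorphic_map ?T ?T (compose X f f')"
      by (rule homeomorphic_map_eq) (simp add: top compose_def)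
    then show "f \<otimes>\<^bsub>BijGroup X\<^esub> f' \<in> subshift_auts G A X"
      using f f' B by (simp add: BijGroup_def subshift_auts_def compose_Bij compose_eq inv mem)
  next
    have "homeomorphic_map ?T ?T (\<lambda>x\<in>X. x)"
      by (rule homeomorphic_map_eq[of _ _ id]) (simp_all add: top)
    then show "\<one>\<^bsub>BijGroup X\<^esub> \<in> subshift_auts G A X"
      by (simp add: BijGroup_def subshift_auts_def id_Bij inv)
  next
    fix f assume f: "f \<in> subshift_auts G A X"
    let ?i = "\<lambda>x\<in>X. inv_into X f x"
    have B: "f \<in> Bij X" and bij: "bij_betw f X X"
      using f by (auto simp: subshift_auts_def Bij_def)
    obtain h where h: "homeomorphic_maps ?T ?T f h"
      using f by (auto simp: subshift_auts_def homeomorphic_map_maps)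
    have hX: "h x \<in> X" "f (h x) = x" if "x \<in> X" for x
      using h that top by (auto simp: homeomorphic_maps_def continuous_map_def)
    have "h x = ?i x" if "x \<in> X" for x
      using hX[OF that] that bij
      by (metis bij_betw_def inv_into_f_f restrict_apply')
    then have "homeomorphic_map ?T ?T ?i"
      using h homeomorphic_map_eq[of ?T ?T h ?i] by (simp add: homeomorphic_maps_map top)
    moreover have "inv_into X f (shift G g x) = shift G g (inv_into X f x)"
      if g: "g \<in> carrier G" and x: "x \<in> X" for g x
    proof -
      have y: "inv_into X f x \<in> X" "f (inv_into X f x) = x"
        using bij x by (simp_all add: Bij_inv_into_mem[OF B] bij_betw_inv_into_right)
      then have "shift G g x = f (shift G g (inv_into X f x))"
        using f g by (simp add: subshift_auts_def)
      then show ?thesis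
        using bij inv[OF g y(1)] by (simp add: bij_betw_inv_into_left)
    qed
    ultimately show "inv\<^bsub>BijGroup X\<^esub> f \<in> subshift_auts G A X"
      using B by (simp add: inv_BijGroup subshift_auts_def restrict_inv_into_Bij inv
          Bij_inv_into_mem del: restrict_apply) (simp add: inv Bij_inv_into_mem)
  qed
  then show ?thesis
    unfolding Aut_subshift_def by (rule subgroup.subgroup_is_group[OF _ group_BijGroup])
qed

end

theory Submission
  imports Defs "HOL-Real_Asymp.Real_Asymp"
begin

text \<open>
  Among all \<open>y \<in> X\<close> choose one for which the set \<open>W\<close> of admissible contents of a large finite block \<open>B\<close>,
  given \<open>y\<close> outside \<open>B\<close>, is as small as possible. Then some finite pattern of \<open>y\<close> around \<open>B\<close> already
  determines \<open>W\<close>, so that next to this pattern any two elements of \<open>W\<close> are interchangeable in \<open>X\<close>, even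
  though \<open>X\<close> need not be of finite type. Rewriting the contents simultaneously at all occurrences that
  are isolated from all others defines an automorphism for each permutation of \<open>W\<close>, and a finite
  group acts faithfully on \<open>W\<close> once \<open>card W\<close> is at least its order. A counting argument extends the
  pattern so that an isolated occurrence exists. As the action of \<open>G\<close> on \<open>X\<close> may have a finite
  kernel, isolation and non-overlap are understood modulo this kernel.
\<close>

section \<open>Rewriting isolated occurrences\<close>

text \<open>Only finitely many contents of \<open>B\<close> fail to fit \<open>y\<close>, and as
  \<open>X\<close> is closed each failure is visible in a finite window. Beside a pattern containing
  these windows contents can only be lost, never gained, and minimality forbids any loss. This
  replaces the border argument available in subshifts of finite type. The main obstacle is
  isolation. The displacements to be excluded, \<open>V\<close>, are built from the window itself,
  so every enlargement made to break a coincidence creates new displacements to break. Counting cuts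
  this circle: with m free bits the number of displacements is a polynomial of degree 4 in m, while
  each displacement outside a set \<open>E\<close> of order m^2 is compatible with at most four of
  the 2^m bit patterns. Those in \<open>E\<close> receive explicit witnesses, each pair costing two
  points of the window. No pattern can break a kernel element, since every configuration is
  invariant under it. Hence \<open>B\<close> is made invariant under the kernel: marks differing by
  a kernel element then have the same block, and rewriting at them agrees. This invariant set is
  finite because gluing two different letters confines the kernel to \<open>K\<close>.\<close>

locale subshift_space = group G for G (structure) +
  fixes A :: "'b set" and X :: "('a \<Rightarrow> 'b) set"
  assumes subshift: "subshift G A X"
begin

section \<open>Closedness expressed through finite windows\<close>

lemma config: "x \<in> X \<Longrightarrow> x \<in> carrier G \<rightarrow>\<^sub>E A"
  using subshift closedin_subset[of "prodiscrete G A" X]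
  by (auto simp: subshift_def prodiscrete_def)

lemma shift_in: "g \<in> carrier G \<Longrightarrow> x \<in> X \<Longrightarrow> shift G g x \<in> X"
  using subshift by (auto simp: subshift_def)

lemma config_eqI:
  assumes "x \<in> X" "y \<in> X" "\<And>k. k \<in> carrier G \<Longrightarrow> x k = y k"
  shows "x = y"
  using config[OF assms(1)] config[OF assms(2)] assms(3) by (auto intro: PiE_ext)

text \<open>A basic open neighbourhood constrains finitely many coordinates only, so one missing
  \<open>X\<close> would contradict agreement on those coordinates. One-point windows already put
  the values of \<open>f\<close> into \<open>A\<close>.\<close>

lemma limit_in:
  assumes ext: "f \<in> extensional (carrier G)"
    and win: "\<And>F. finite F \<Longrightarrow> F \<subseteq> carrier G \<Longrightarrow> \<exists>x\<in>X. \<forall>k\<in>F. x k = f k"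
  shows "f \<in> X"
proof (rule ccontr)
  assume "f \<notin> X"
  have "f k \<in> A" if k: "k \<in> carrier G" for k
  proof -
    obtain x where "x \<in> X" "x k = f k" using win[of "{k}"] k by auto
    then show ?thesis using config[of x] k by (auto dest: PiE_mem)
  qed
  then have f: "f \<in> carrier G \<rightarrow>\<^sub>E A"
    using ext by (auto simp: PiE_def)
  have "openin (prodiscrete G A) (topspace (prodiscrete G A) - X)"
    using subshift by (auto simp: subshift_def closedin_def)
  moreover have "f \<in> topspace (prodiscrete G A) - X"
    using f \<open>f \<notin> X\<close> by (simp add: prodiscrete_def)
  ultimately have "\<exists>U. finite {i \<in> carrier G. U i \<noteq> topspace (discrete_topology A)} \<and>
      (\<forall>i\<in>carrier G. openin (discrete_topology A) (U i)) \<and> f \<in> Pi\<^sub>E (carrier G) U \<and>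
      Pi\<^sub>E (carrier G) U \<subseteq> topspace (prodiscrete G A) - X"
    unfolding prodiscrete_def openin_product_topology_alt by (rule bspec)
  then obtain U where U: "finite {i \<in> carrier G. U i \<noteq> A}" "f \<in> Pi\<^sub>E (carrier G) U"
    "Pi\<^sub>E (carrier G) U \<subseteq> (carrier G \<rightarrow>\<^sub>E A) - X"
    by (auto simp: prodiscrete_def)
  obtain x where x: "x \<in> X" "\<forall>k\<in>{i \<in> carrier G. U i \<noteq> A}. x k = f k"
    using win[OF U(1)] by blast
  have "x \<in> Pi\<^sub>E (carrier G) U"
  proof (rule PiE_I)
    fix k assume k: "k \<in> carrier G"
    show "x k \<in> U k"
    proof (cases "U k = A")
      case True
      then show ?thesis using config[OF x(1)] k by auto
    next
      case False
      then show ?thesis using x(2) U(2) k by (auto simp: PiE_def Pi_def)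
    qed
  next
    fix k assume "k \<notin> carrier G"
    then show "x k = undefined" using config[OF x(1)] by auto
  qed
  then show False using U(3) x(1) by blast
qed

lemma excluded_window:
  assumes "f \<in> extensional (carrier G)" "f \<notin> X"
  shows "\<exists>F. finite F \<and> F \<subseteq> carrier G \<and> (\<forall>x\<in>X. \<exists>k\<in>F. x k \<noteq> f k)"
proof (rule ccontr)
  assume "\<not> ?thesis"
  then have "\<exists>x\<in>X. \<forall>k\<in>F. x k = f k" if "finite F" "F \<subseteq> carrier G" for F
    using that by meson
  then show False using limit_in[OF assms(1)] assms(2) by blast
qed

text \<open>Moves position \<open>g\<close> to the identity: a pattern occurs in \<open>x\<close> at
  \<open>g\<close> exactly when it occurs in \<open>translate g x\<close> at the identity.\<close>

definition translate :: "'a \<Rightarrow> ('a \<Rightarrow> 'b) \<Rightarrow> 'a \<Rightarrow> 'b" where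
  "translate g x = shift G (inv g) x"

lemma translate_apply [simp]:
  "g \<in> carrier G \<Longrightarrow> k \<in> carrier G \<Longrightarrow> translate g x k = x (g \<otimes> k)"
  by (simp add: translate_def shift_def)

lemma translate_in [simp]: "g \<in> carrier G \<Longrightarrow> x \<in> X \<Longrightarrow> translate g x \<in> X"
  by (simp add: translate_def shift_in)

definition kernel_of_action :: "'a set" where
  "kernel_of_action = {n \<in> carrier G. \<forall>x\<in>X. \<forall>k\<in>carrier G. x (n \<otimes> k) = x k}"

lemma kernel_carrier: "n \<in> kernel_of_action \<Longrightarrow> n \<in> carrier G"
  by (simp add: kernel_of_action_def)

lemma kernel_apply:
  "n \<in> kernel_of_action \<Longrightarrow> x \<in> X \<Longrightarrow> k \<in> carrier G \<Longrightarrow> x (n \<otimes> k) = x k"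
  by (simp add: kernel_of_action_def)

lemma subgroup_kernel: "subgroup kernel_of_action G"
proof (rule subgroupI)
  show "kernel_of_action \<noteq> {}" by (auto simp: kernel_of_action_def)
next
  fix n assume n: "n \<in> kernel_of_action"
  then have "x (inv n \<otimes> k) = x k" if "x \<in> X" "k \<in> carrier G" for x k
    using that kernel_apply[OF n that(1), of "inv n \<otimes> k"] kernel_carrier[OF n]
    by (simp add: m_assoc[symmetric])
  then show "inv n \<in> kernel_of_action"
    using kernel_carrier[OF n] by (simp add: kernel_of_action_def)
qed (auto simp: kernel_of_action_def m_assoc)

text \<open>Normality, by testing the conjugate on \<open>translate r x\<close>, which is again in
  \<open>X\<close>. It keeps conjugates of non-kernel elements outside the kernel in
  \<open>generic_witness\<close>.\<close>

lemma kernel_conj: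
  assumes "r \<in> carrier G" "h \<in> carrier G" "inv r \<otimes> h \<otimes> r \<in> kernel_of_action"
  shows "h \<in> kernel_of_action"
proof -
  have "x (h \<otimes> k) = x k" if "x \<in> X" "k \<in> carrier G" for x k
    using kernel_apply[OF assms(3), of "translate r x" "inv r \<otimes> k"] assms(1,2) that
    by (simp add: m_assoc inv_solve_left) (simp add: m_assoc[symmetric])
  then show ?thesis using assms(2) by (simp add: kernel_of_action_def)
qed

end

text \<open>
  The window \<open>T\<close> carries a synchronising pattern \<open>c\<close>: wherever it occurs, the content of \<open>B\<close> ranges
  over \<open>W\<close>, independently of the rest of the configuration.
\<close>

locale exchange = subshift_space G A X
  for G (structure) and A :: "'b set" and X :: "('a \<Rightarrow> 'b) set" +
  fixes B T :: "'a set" and c :: "'a \<Rightarrow> 'b" and W :: "('a \<Rightarrow> 'b) set"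
  assumes B: "finite B" "B \<subseteq> carrier G" "\<And>n b. n \<in> kernel_of_action \<Longrightarrow> b \<in> B \<Longrightarrow> n \<otimes> b \<in> B"
    and T: "finite T" "T \<subseteq> carrier G" "T \<inter> B = {}"
    and content: "\<And>x. x \<in> X \<Longrightarrow> \<forall>t\<in>T. x t = c t \<Longrightarrow> restrict x B \<in> W"
    and exchange: "\<And>x w. x \<in> X \<Longrightarrow> \<forall>t\<in>T. x t = c t \<Longrightarrow> w \<in> W \<Longrightarrow>
      (\<lambda>k. if k \<in> B then w k else x k) \<in> X"
begin

section \<open>Marks: isolated occurrences of the synchronising pattern\<close>

definition put :: "('a \<Rightarrow> 'b) \<Rightarrow> ('a \<Rightarrow> 'b) \<Rightarrow> 'a \<Rightarrow> 'b" where
  "put x w = (\<lambda>k. if k \<in> B then w k else x k)"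

text \<open>If the blocks at \<open>e\<close> and \<open>f\<close> both meet the translate of
  \<open>B \<union> T\<close> at \<open>h\<close>, say \<open>e \<otimes> b = h \<otimes> d\<close>
  and \<open>f \<otimes> b' = h \<otimes> d'\<close>, then \<open>inv e \<otimes> f\<close> is the
  product displayed here. Taking \<open>d' = b'\<close> or \<open>d = b\<close> also yields the
  displacements at which one block meets another block or window.\<close>

definition V :: "'a set" where
  "V = (\<lambda>(b, d, d', b'). b \<otimes> inv d \<otimes> (d' \<otimes> inv b')) ` (B \<times> (B \<union> T) \<times> (B \<union> T) \<times> B)"

text \<open>
  The condition on \<open>V\<close> keeps marked positions apart. Quantifying over all contents \<open>w\<close> makes it
  insensitive to the rewriting, so that \<open>c\<close> may well overlap itself.
\<close>

definition marked :: "('a \<Rightarrow> 'b) \<Rightarrow> bool" where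
  "marked x \<longleftrightarrow> (\<forall>t\<in>T. x t = c t) \<and>
     (\<forall>w\<in>W. \<forall>v\<in>V - kernel_of_action. \<exists>t\<in>T. put x w (v \<otimes> t) \<noteq> c t)"

definition marks :: "('a \<Rightarrow> 'b) \<Rightarrow> 'a set" where
  "marks x = {g \<in> carrier G. marked (translate g x)}"

definition pat :: "'a \<Rightarrow> ('a \<Rightarrow> 'b) \<Rightarrow> 'a \<Rightarrow> 'b" where
  "pat g x = restrict (translate g x) B"

abbreviation "N \<equiv> kernel_of_action"

lemma Bc: "b \<in> B \<Longrightarrow> b \<in> carrier G" and Tc: "t \<in> T \<Longrightarrow> t \<in> carrier G"
  using B T by auto

lemma marks_carrier: "g \<in> marks x \<Longrightarrow> g \<in> carrier G"
  by (simp add: marks_def)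

lemma V_carrier: "V \<subseteq> carrier G"
  using Bc Tc by (auto simp: V_def)

lemma finite_V: "finite V"
  using B T by (auto simp: V_def)

lemma V_I:
  assumes "b \<in> B" "b' \<in> B" "d \<in> B \<union> T" "d' \<in> B \<union> T"
  shows "b \<otimes> inv d \<otimes> (d' \<otimes> inv b') \<in> V"
  unfolding V_def using assms by (intro image_eqI[where x="(b,d,d',b')"]) auto

lemma V_BB:
  assumes "b \<in> B" "d \<in> B \<union> T"
  shows "b \<otimes> inv d \<in> V" "d \<otimes> inv b \<in> V"
  using V_I[of b b d b] V_I[of b b b d] assms Bc Tc by auto

lemma marks_c: "g \<in> marks x \<Longrightarrow> t \<in> T \<Longrightarrow> x (g \<otimes> t) = c t"
  unfolding marks_def marked_def using Tc by fastforce

lemma pat_W: "x \<in> X \<Longrightarrow> g \<in> marks x \<Longrightarrow> pat g x \<in> W"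
  unfolding pat_def by (rule content) (auto simp: marks_def marked_def)

text \<open>Writing \<open>w\<close> into the block gives an element of \<open>X\<close>, and kernel
  elements fix all of these. This makes rewriting well defined where several marks share a
  block.\<close>

lemma W_kernel:
  assumes "x \<in> X" "g \<in> marks x" "w \<in> W" "n \<in> N" "b \<in> B"
  shows "w (n \<otimes> b) = w b"
proof -
  have "(\<lambda>k. if k \<in> B then w k else translate g x k) \<in> X"
    by (rule exchange) (use assms in \<open>auto simp: marks_def marked_def\<close>)
  from kernel_apply[OF assms(4) this, of b] show ?thesis
    using assms B by (auto split: if_splits)
qed

text \<open>Isolation is applied with \<open>w\<close> the content already present at
  \<open>g\<close>, so that \<open>put\<close> changes nothing. The position \<open>h\<close> only
  has to carry the pattern; it need not be marked.\<close>

lemma marks_sep: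
  assumes "x \<in> X" "g \<in> marks x" "h \<in> carrier G" "\<forall>t\<in>T. x (h \<otimes> t) = c t" "inv g \<otimes> h \<in> V"
  shows "inv g \<otimes> h \<in> N"
proof (rule ccontr)
  assume "inv g \<otimes> h \<notin> N"
  moreover have g: "g \<in> carrier G" using assms marks_carrier by blast
  ultimately obtain t where t: "t \<in> T" "put (translate g x) (pat g x) (inv g \<otimes> h \<otimes> t) \<noteq> c t"
    using assms pat_W[OF assms(1,2)] unfolding marks_def marked_def by blast
  have "put (translate g x) (pat g x) (inv g \<otimes> h \<otimes> t) = x (g \<otimes> (inv g \<otimes> h \<otimes> t))"
    using g assms t Tc by (auto simp: put_def pat_def)
  also have "g \<otimes> (inv g \<otimes> h \<otimes> t) = h \<otimes> t"
    using g assms t Tc by (simp add: m_assoc[symmetric])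
  finally show False using t assms by auto
qed

lemma marks_sep2:
  "x \<in> X \<Longrightarrow> g \<in> marks x \<Longrightarrow> h \<in> marks x \<Longrightarrow> inv g \<otimes> h \<in> V \<Longrightarrow> inv g \<otimes> h \<in> N"
  using marks_sep marks_c marks_carrier by blast

lemma quotient_eq:
  assumes "g \<in> carrier G" "h \<in> carrier G" "b \<in> carrier G" "d \<in> carrier G" "g \<otimes> b = h \<otimes> d"
  shows "inv g \<otimes> h = b \<otimes> inv d"
  using assms by (metis inv_closed inv_solve_left' inv_solve_right' m_assoc m_closed)

lemma translate_kernel:
  assumes "x \<in> X" "g \<in> carrier G" "h \<in> carrier G" "inv g \<otimes> h \<in> N"
  shows "translate h x = translate g x"
proof (rule config_eqI)
  fix k assume k: "k \<in> carrier G"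
  have "translate g x (inv g \<otimes> h \<otimes> k) = translate g x k"
    using kernel_apply[OF assms(4) translate_in] k assms by blast
  moreover have "g \<otimes> (inv g \<otimes> h \<otimes> k) = h \<otimes> k"
    using assms k by (simp add: m_assoc[symmetric])
  ultimately show "translate h x k = translate g x k" using assms k by simp
qed (use assms in auto)

lemma marks_kernel:
  assumes "x \<in> X" "g \<in> marks x" "h \<in> carrier G" "inv g \<otimes> h \<in> N"
  shows "h \<in> marks x" "pat h x = pat g x"
  using assms translate_kernel[OF assms(1) marks_carrier[OF assms(2)] assms(3,4)]
  by (auto simp: marks_def pat_def)

lemma kernel_coset:
  assumes "g \<in> carrier G" "h \<in> carrier G" "inv g \<otimes> h \<in> N" "b \<in> B"
  obtains b' where "b' \<in> B" "h \<otimes> b = g \<otimes> b'" "b' = inv g \<otimes> h \<otimes> b"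
proof
  show "inv g \<otimes> h \<otimes> b \<in> B" using B assms by blast
  show "h \<otimes> b = g \<otimes> (inv g \<otimes> h \<otimes> b)"
    using assms Bc by (simp add: m_assoc[symmetric])
qed simp

lemma kernel_sym: "g \<in> carrier G \<Longrightarrow> h \<in> carrier G \<Longrightarrow> inv g \<otimes> h \<in> N \<Longrightarrow> inv h \<otimes> g \<in> N"
  using subgroup.m_inv_closed[OF subgroup_kernel, of "inv g \<otimes> h"] by (simp add: inv_mult_group)

text \<open>A meeting would give a displacement in \<open>V\<close>, hence in the kernel; the two
  blocks would then coincide, but \<open>T\<close> misses \<open>B\<close>. Rewriting therefore
  leaves the pattern around every mark intact.\<close>

lemma marks_T_disjoint:
  assumes "x \<in> X" "g \<in> marks x" "h \<in> marks x" "t \<in> T" "b \<in> B"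
  shows "g \<otimes> t \<noteq> h \<otimes> b"
proof
  assume eq: "g \<otimes> t = h \<otimes> b"
  have c: "g \<in> carrier G" "h \<in> carrier G" using assms marks_carrier by auto
  have "inv g \<otimes> h = t \<otimes> inv b" using quotient_eq[OF c _ _ eq] assms Bc Tc by auto
  then have "inv g \<otimes> h \<in> V" using V_BB(2)[of b t] assms by auto
  then have "inv g \<otimes> h \<in> N" using marks_sep2 assms by blast
  then obtain b' where "b' \<in> B" "h \<otimes> b = g \<otimes> b'"
    using kernel_coset c assms by metis
  then show False using eq c assms Bc Tc T(3) by auto
qed

text \<open>
  Only the marks in a subset \<open>M\<close> are rewritten, so that the lemma also applies to the inverse rewriting,
  for which the marks of the source are not yet known.
\<close>

lemma marks_mono:
  assumes x: "x \<in> X" and M: "M \<subseteq> marks x" and \<sigma>: "\<And>g. g \<in> M \<Longrightarrow> \<sigma> g \<in> W"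
    and upd: "\<And>g b. g \<in> M \<Longrightarrow> b \<in> B \<Longrightarrow> x' (g \<otimes> b) = \<sigma> g b"
    and unch: "\<And>k. k \<in> carrier G \<Longrightarrow> \<forall>g\<in>M. \<forall>b\<in>B. k \<noteq> g \<otimes> b \<Longrightarrow> x' k = x k"
  shows "marks x \<subseteq> marks x'"
proof
  fix g assume g: "g \<in> marks x"
  have gc: "g \<in> carrier G" using g marks_carrier by blast
  have Mc: "\<And>h. h \<in> M \<Longrightarrow> h \<in> carrier G" using M marks_carrier by blast
  have "x' (g \<otimes> t) = c t" if t: "t \<in> T" for t
  proof -
    have "\<forall>h\<in>M. \<forall>b\<in>B. g \<otimes> t \<noteq> h \<otimes> b" using marks_T_disjoint[OF x g _ t] M by blast
    then show ?thesis using unch[of "g \<otimes> t"] marks_c[OF g t] gc Tc t by auto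
  qed
  moreover have "\<exists>t\<in>T. put (translate g x') w (v \<otimes> t) \<noteq> c t"
    if w: "w \<in> W" and v: "v \<in> V - N" for w v
  proof -
    define h where "h = g \<otimes> v"
    have vc: "v \<in> carrier G" using v V_carrier by auto
    then have hc: "h \<in> carrier G" using gc h_def by auto
    have gh: "inv g \<otimes> h = v" using gc vc by (simp add: h_def m_assoc[symmetric])
    define y where "y k = (if inv g \<otimes> k \<in> B then w (inv g \<otimes> k) else x' k)" for k
    have y: "put (translate g x') w (v \<otimes> t) = y (h \<otimes> t)" if "t \<in> T" for t
    proof -
      have "inv g \<otimes> (h \<otimes> t) = v \<otimes> t" "g \<otimes> (v \<otimes> t) = h \<otimes> t"
        using that Tc gc vc by (auto simp: h_def m_assoc[symmetric])
      then show ?thesis using that Tc gc vc by (auto simp: put_def y_def)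
    qed
    \<comment> \<open>On the window at \<open>h\<close>, \<open>y\<close> is just \<open>x\<close>
      with the block of a single mark \<open>f\<close> refilled by \<open>u\<close>, because
      \<open>V\<close> prevents one window from meeting two different blocks. Isolation of
      \<open>f\<close> in \<open>x\<close>, valid for every content, then provides the mismatch. If
      a rewritten block other than that of \<open>g\<close> is met, \<open>f\<close> is its mark;
      otherwise \<open>f\<close> is \<open>g\<close>.\<close>
    have "\<exists>f u. f \<in> marks x \<and> u \<in> W \<and> inv f \<otimes> h \<in> V - N \<and>
        (\<forall>t\<in>T. y (h \<otimes> t) = put (translate f x) u (inv f \<otimes> (h \<otimes> t)))"
    proof (cases "\<exists>f\<in>M. inv g \<otimes> f \<notin> N \<and> (\<exists>t\<in>T. \<exists>b\<in>B. h \<otimes> t = f \<otimes> b)")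
      case True
      then obtain f t0 b0 where f: "f \<in> M" "inv g \<otimes> f \<notin> N" "t0 \<in> T" "b0 \<in> B"
        and ht0: "h \<otimes> t0 = f \<otimes> b0" by blast
      have fm: "f \<in> marks x" and fc: "f \<in> carrier G" using f M Mc by auto
      have e: "inv f \<otimes> h = b0 \<otimes> inv t0"
        using quotient_eq[OF fc hc _ _ ht0[symmetric]] f Bc Tc by auto
      then have fV: "inv f \<otimes> h \<in> V" using V_BB f by auto
      have "inv f \<otimes> h \<notin> N"
      proof
        assume "inv f \<otimes> h \<in> N"
        then have "h \<in> marks x" using marks_kernel(1)[OF x fm hc] by blast
        then show False using marks_sep2[OF x g] v gh by auto
      qed
      moreover have "y (h \<otimes> t) = put (translate f x) (\<sigma> f) (inv f \<otimes> (h \<otimes> t))" if t: "t \<in> T" for t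
      proof (cases "\<exists>b\<in>B. h \<otimes> t = f \<otimes> b")
        case True
        then obtain b where b: "b \<in> B" "h \<otimes> t = f \<otimes> b" by blast
        have fb: "inv f \<otimes> (h \<otimes> t) = b" using b fc Bc by (simp add: m_assoc[symmetric])
        have "inv g \<otimes> (h \<otimes> t) \<notin> B"
        proof
          assume b': "inv g \<otimes> (h \<otimes> t) \<in> B"
          have "g \<otimes> (inv g \<otimes> (h \<otimes> t)) = f \<otimes> b"
            using b gc hc t Tc fc Bc by (simp add: m_assoc[symmetric])
          then have "inv g \<otimes> f = (inv g \<otimes> (h \<otimes> t)) \<otimes> inv b"
            using quotient_eq[OF gc fc] b' b Bc by blast
          then have "inv g \<otimes> f \<in> V" using V_BB b b' by auto
          then show False using marks_sep2[OF x g fm] f by blast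
        qed
        then show ?thesis using fb b f upd[of f b] by (simp add: y_def put_def)
      next
        case False
        have nf: "inv f \<otimes> (h \<otimes> t) \<notin> B"
        proof
          assume "inv f \<otimes> (h \<otimes> t) \<in> B"
          moreover have "h \<otimes> t = f \<otimes> (inv f \<otimes> (h \<otimes> t))"
            using fc hc t Tc by (simp add: m_assoc[symmetric])
          ultimately show False using False by blast
        qed
        \<comment> \<open>Here all four factors in \<open>V\<close> are used: the blocks at
          \<open>e\<close> and \<open>f\<close> would meet the window at \<open>h\<close> in
          \<open>h \<otimes> t\<close> and \<open>h \<otimes> t0\<close>.\<close>
        have none: "h \<otimes> t \<noteq> e \<otimes> b" if e: "e \<in> marks x" and b: "b \<in> B" for e b
        proof
          assume eq: "h \<otimes> t = e \<otimes> b"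
          have ec: "e \<in> carrier G" using e marks_carrier by blast
          have "inv e \<otimes> h = b \<otimes> inv t" using quotient_eq[OF ec hc _ _ eq[symmetric]] b t Bc Tc by auto
          moreover have "inv h \<otimes> f = t0 \<otimes> inv b0" using quotient_eq[OF hc fc _ _ ht0] f Bc Tc by auto
          moreover have "inv e \<otimes> f = (inv e \<otimes> h) \<otimes> (inv h \<otimes> f)"
            using ec hc fc by (simp add: m_assoc inv_solve_left) (simp add: m_assoc[symmetric])
          ultimately have "inv e \<otimes> f \<in> V" using V_I[of b b0 t t0] b t f by auto
          then have "inv e \<otimes> f \<in> N" using marks_sep2[OF x e fm] by blast
          then have "inv f \<otimes> e \<in> N" using kernel_sym ec fc by blast
          then obtain b' where "b' \<in> B" "e \<otimes> b = f \<otimes> b'" using kernel_coset ec fc b by metis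
          then show False using False eq by auto
        qed
        have "inv g \<otimes> (h \<otimes> t) \<notin> B"
        proof
          assume "inv g \<otimes> (h \<otimes> t) \<in> B"
          moreover have "h \<otimes> t = g \<otimes> (inv g \<otimes> (h \<otimes> t))"
            using gc hc t Tc by (simp add: m_assoc[symmetric])
          ultimately show False using none[OF g] by blast
        qed
        moreover have "x' (h \<otimes> t) = x (h \<otimes> t)" using unch[of "h \<otimes> t"] none M hc t Tc by blast
        moreover have "f \<otimes> (inv f \<otimes> (h \<otimes> t)) = h \<otimes> t"
          using fc hc t Tc by (simp add: m_assoc[symmetric])
        ultimately show ?thesis using nf fc hc t Tc by (simp add: y_def put_def)
      qed
      ultimately show ?thesis using fm fV \<sigma>[OF f(1)] by blast
    next
      case False
      have "y (h \<otimes> t) = put (translate g x) w (inv g \<otimes> (h \<otimes> t))" if t: "t \<in> T" for t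
      proof (cases "inv g \<otimes> (h \<otimes> t) \<in> B")
        case True
        then show ?thesis by (simp add: y_def put_def)
      next
        case F: False
        have "h \<otimes> t \<noteq> f \<otimes> b" if f: "f \<in> M" and b: "b \<in> B" for f b
        proof
          assume eq: "h \<otimes> t = f \<otimes> b"
          then have "inv g \<otimes> f \<in> N" using False f b t by blast
          then obtain b' where b': "b' \<in> B" "f \<otimes> b = g \<otimes> b'"
            using kernel_coset[OF gc Mc[OF f] _ b] by metis
          then have "inv g \<otimes> (h \<otimes> t) = b'" using eq gc Bc by (simp add: m_assoc[symmetric])
          then show False using F b' by simp
        qed
        then have "x' (h \<otimes> t) = x (h \<otimes> t)" using unch[of "h \<otimes> t"] hc t Tc by blast
        moreover have "g \<otimes> (inv g \<otimes> (h \<otimes> t)) = h \<otimes> t"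
          using gc hc t Tc by (simp add: m_assoc[symmetric])
        ultimately show ?thesis using F gc hc t Tc by (simp add: y_def put_def)
      qed
      then show ?thesis using g w v gh by blast
    qed
    then obtain f u where fu: "f \<in> marks x" "u \<in> W" "inv f \<otimes> h \<in> V - N"
      "\<forall>t\<in>T. y (h \<otimes> t) = put (translate f x) u (inv f \<otimes> (h \<otimes> t))" by blast
    then obtain t where t: "t \<in> T" "put (translate f x) u (inv f \<otimes> h \<otimes> t) \<noteq> c t"
      unfolding marks_def marked_def by blast
    then have "y (h \<otimes> t) \<noteq> c t" using fu marks_carrier[OF fu(1)] hc Tc by (simp add: m_assoc)
    then show ?thesis using y t by auto
  qed
  ultimately show "g \<in> marks x'" using gc Tc unfolding marks_def marked_def by auto
qed

end

section \<open>The rewriting map and its composition laws\<close>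

context exchange
begin

text \<open>Marks whose blocks contain \<open>k\<close> differ by kernel elements;
  \<open>overlap_consistent\<close> shows that the choice among them is immaterial.\<close>

definition rewrite :: "(('a \<Rightarrow> 'b) \<Rightarrow> ('a \<Rightarrow> 'b)) \<Rightarrow> ('a \<Rightarrow> 'b) \<Rightarrow> 'a \<Rightarrow> 'b" where
  "rewrite \<tau> x = (\<lambda>k\<in>carrier G.
     if \<exists>g\<in>marks x. inv g \<otimes> k \<in> B
     then let g = SOME g. g \<in> marks x \<and> inv g \<otimes> k \<in> B in \<tau> (pat g x) (inv g \<otimes> k)
     else x k)"

lemma in_block_iff:
  assumes "g \<in> carrier G" "k \<in> carrier G"
  shows "inv g \<otimes> k \<in> B \<longleftrightarrow> (\<exists>b\<in>B. k = g \<otimes> b)"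
proof
  assume "inv g \<otimes> k \<in> B"
  moreover have "k = g \<otimes> (inv g \<otimes> k)" using assms by (simp add: m_assoc[symmetric])
  ultimately show "\<exists>b\<in>B. k = g \<otimes> b" by blast
next
  assume "\<exists>b\<in>B. k = g \<otimes> b"
  then show "inv g \<otimes> k \<in> B" using assms Bc by (auto simp: m_assoc[symmetric])
qed

lemma block_overlap:
  assumes "x \<in> X" "g \<in> marks x" "h \<in> marks x" "b \<in> B" "b' \<in> B" "g \<otimes> b = h \<otimes> b'"
  shows "inv g \<otimes> h \<in> N"
proof -
  have "g \<in> carrier G" "h \<in> carrier G" using assms marks_carrier by auto
  then have "inv g \<otimes> h = b \<otimes> inv b'" using quotient_eq assms Bc by blast
  then show ?thesis using marks_sep2[OF assms(1-3)] V_BB(1)[of b b'] assms by auto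
qed

lemma overlap_consistent:
  assumes "x \<in> X" "\<tau> \<in> W \<rightarrow> W" "g \<in> marks x" "h \<in> marks x" "b \<in> B" "b' \<in> B"
    "g \<otimes> b = h \<otimes> b'"
  shows "\<tau> (pat g x) b = \<tau> (pat h x) b'"
proof -
  have c: "g \<in> carrier G" "h \<in> carrier G" using assms marks_carrier by auto
  have n: "inv g \<otimes> h \<in> N" using block_overlap assms by blast
  have p: "pat h x = pat g x" using marks_kernel[OF assms(1,3) c(2) n] by blast
  have "g \<otimes> b = g \<otimes> (inv g \<otimes> h \<otimes> b')"
    using assms c Bc by (simp add: m_assoc[symmetric])
  then have "b = inv g \<otimes> h \<otimes> b'"
    using c assms Bc by simp
  then show ?thesis
    using p W_kernel[OF assms(1,3) _ n, of "\<tau> (pat g x)" b'] pat_W[OF assms(1,3)] assms by auto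
qed

lemma rewrite_on:
  assumes "x \<in> X" "\<tau> \<in> W \<rightarrow> W" "g \<in> marks x" "b \<in> B"
  shows "rewrite \<tau> x (g \<otimes> b) = \<tau> (pat g x) b"
proof -
  define k where "k = g \<otimes> b"
  have gc: "g \<in> carrier G" using assms marks_carrier by auto
  have kc: "k \<in> carrier G" using gc assms Bc k_def by auto
  define h where "h = (SOME g. g \<in> marks x \<and> inv g \<otimes> k \<in> B)"
  have ex: "\<exists>g\<in>marks x. inv g \<otimes> k \<in> B"
    using in_block_iff[OF gc kc] assms k_def by auto
  then have h: "h \<in> marks x" "inv h \<otimes> k \<in> B"
    unfolding h_def using someI_ex[of "\<lambda>g. g \<in> marks x \<and> inv g \<otimes> k \<in> B"] by blast+
  have hc: "h \<in> carrier G" using h marks_carrier by auto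
  have "rewrite \<tau> x k = \<tau> (pat h x) (inv h \<otimes> k)"
    using ex kc unfolding rewrite_def h_def Let_def by simp
  also have "\<dots> = \<tau> (pat g x) b"
    by (rule overlap_consistent[OF assms(1,2) h(1) assms(3) h(2) assms(4)])
       (use hc kc k_def in \<open>simp add: m_assoc[symmetric]\<close>)
  finally show ?thesis by (simp add: k_def)
qed

lemma rewrite_off:
  assumes "k \<in> carrier G" "\<forall>g\<in>marks x. \<forall>b\<in>B. k \<noteq> g \<otimes> b"
  shows "rewrite \<tau> x k = x k"
  using assms in_block_iff[OF marks_carrier assms(1)] by (auto simp: rewrite_def)

text \<open>The exchange property alters one block at a time, whence the induction. Blocks rewritten
  earlier miss the window at \<open>g\<close>, so the pattern still stands there and exchange
  applies again. If the block at \<open>g\<close> meets an earlier one, it equals it and is already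
  correct.\<close>

lemma rewrite_finitely_many:
  assumes x: "x \<in> X" and \<tau>: "\<tau> \<in> W \<rightarrow> W" and M: "finite M" "M \<subseteq> marks x"
  shows "\<exists>y\<in>X. (\<forall>g\<in>M. \<forall>b\<in>B. y (g \<otimes> b) = \<tau> (pat g x) b) \<and>
    (\<forall>k\<in>carrier G. (\<forall>g\<in>M. \<forall>b\<in>B. k \<noteq> g \<otimes> b) \<longrightarrow> y k = x k)"
  using M
proof (induction M rule: finite_induct)
  case empty
  then show ?case using x by blast
next
  case (insert g M)
  then obtain y where y: "y \<in> X" "\<forall>g\<in>M. \<forall>b\<in>B. y (g \<otimes> b) = \<tau> (pat g x) b"
    "\<forall>k\<in>carrier G. (\<forall>g\<in>M. \<forall>b\<in>B. k \<noteq> g \<otimes> b) \<longrightarrow> y k = x k" by auto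
  have g: "g \<in> marks x" and gc: "g \<in> carrier G" and Mm: "M \<subseteq> marks x"
    using insert.prems marks_carrier by auto
  show ?case
  proof (cases "\<exists>h\<in>M. \<exists>b\<in>B. \<exists>b'\<in>B. g \<otimes> b = h \<otimes> b'")
    case True
    then obtain h b0 b0' where h: "h \<in> M" "b0 \<in> B" "b0' \<in> B" "g \<otimes> b0 = h \<otimes> b0'" by blast
    have hm: "h \<in> marks x" and hc: "h \<in> carrier G" using h Mm marks_carrier by auto
    have n: "inv h \<otimes> g \<in> N" using block_overlap[OF x hm g h(3,2)] h(4) by simp
    have "y (g \<otimes> b) = \<tau> (pat g x) b" if b: "b \<in> B" for b
    proof -
      obtain b' where b': "b' \<in> B" "g \<otimes> b = h \<otimes> b'" using kernel_coset[OF hc gc n b] by metis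
      then show ?thesis
        using y(2) h(1) overlap_consistent[OF x \<tau> g hm b b'(1) b'(2)] by simp
    qed
    then show ?thesis using y by (intro bexI[of _ y]) auto
  next
    case False
    have yc: "\<forall>t\<in>T. translate g y t = c t"
    proof
      fix t assume t: "t \<in> T"
      have "\<forall>h\<in>M. \<forall>b\<in>B. g \<otimes> t \<noteq> h \<otimes> b"
        using marks_T_disjoint[OF x g _ t] Mm by blast
      then show "translate g y t = c t" using y(3) gc Tc t marks_c[OF g t] by auto
    qed
    define z where "z = put (translate g y) (\<tau> (pat g x))"
    have "\<tau> (pat g x) \<in> W" using \<tau> pat_W[OF x g] by auto
    then have zX: "z \<in> X"
      unfolding z_def put_def using exchange[OF translate_in[OF gc y(1)] yc] by blast
    define z' where "z' = translate (inv g) z"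
    have z': "z' k = (if inv g \<otimes> k \<in> B then \<tau> (pat g x) (inv g \<otimes> k) else y k)"
      if "k \<in> carrier G" for k
      using that gc by (simp add: z'_def z_def put_def) (simp add: m_assoc[symmetric])
    have "z' (g \<otimes> b) = \<tau> (pat g x) b" if "b \<in> B" for b
      using z'[of "g \<otimes> b"] that gc Bc by (simp add: m_assoc[symmetric])
    moreover have "z' (h \<otimes> b) = \<tau> (pat h x) b" if h: "h \<in> M" and b: "b \<in> B" for h b
    proof -
      have hc: "h \<in> carrier G" using h Mm marks_carrier by auto
      have "inv g \<otimes> (h \<otimes> b) \<notin> B"
        using in_block_iff[OF gc, of "h \<otimes> b"] False h b hc Bc by (metis m_closed)
      then show ?thesis using z'[of "h \<otimes> b"] h b hc Bc y(2) by simp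
    qed
    moreover have "z' k = x k" if k: "k \<in> carrier G" "\<forall>h\<in>insert g M. \<forall>b\<in>B. k \<noteq> h \<otimes> b" for k
    proof -
      have "inv g \<otimes> k \<notin> B" using in_block_iff[OF gc k(1)] k(2) by blast
      then show ?thesis using z'[OF k(1)] k y(3) by auto
    qed
    ultimately show ?thesis using translate_in[OF inv_closed[OF gc] zX] z'_def by blast
  qed
qed

text \<open>A finite window meets the blocks of finitely many marks, so there the simultaneous
  rewriting agrees with a finite one, and closedness finishes.\<close>

lemma rewrite_in:
  assumes x: "x \<in> X" and \<tau>: "\<tau> \<in> W \<rightarrow> W"
  shows "rewrite \<tau> x \<in> X"
proof (rule limit_in)
  show "rewrite \<tau> x \<in> extensional (carrier G)" by (simp add: rewrite_def)
next
  fix F assume F: "finite F" "F \<subseteq> carrier G"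
  define M where "M = {g \<in> marks x. \<exists>b\<in>B. g \<otimes> b \<in> F}"
  have "M \<subseteq> (\<lambda>(k, b). k \<otimes> inv b) ` (F \<times> B)"
  proof
    fix g assume "g \<in> M"
    then obtain b where "g \<in> carrier G" "b \<in> B" "g \<otimes> b \<in> F" using M_def marks_carrier by auto
    then show "g \<in> (\<lambda>(k, b). k \<otimes> inv b) ` (F \<times> B)"
      using Bc by (intro image_eqI[of _ _ "(g \<otimes> b, b)"]) (auto simp: m_assoc)
  qed
  then have "finite M" using F B finite_subset by blast
  then obtain y where y: "y \<in> X" "\<forall>g\<in>M. \<forall>b\<in>B. y (g \<otimes> b) = \<tau> (pat g x) b"
    "\<forall>k\<in>carrier G. (\<forall>g\<in>M. \<forall>b\<in>B. k \<noteq> g \<otimes> b) \<longrightarrow> y k = x k"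
    using rewrite_finitely_many[OF x \<tau>, of M] M_def by auto
  have "y k = rewrite \<tau> x k" if k: "k \<in> F" for k
  proof (cases "\<exists>g\<in>marks x. \<exists>b\<in>B. k = g \<otimes> b")
    case True
    then show ?thesis using rewrite_on[OF x \<tau>] y(2) k M_def by auto
  next
    case False
    then show ?thesis using rewrite_off[of k x \<tau>] y(3) k F M_def by auto
  qed
  then show "\<exists>y\<in>X. \<forall>k\<in>F. y k = rewrite \<tau> x k" using y(1) by blast
qed

text \<open>For the reverse inclusion \<open>x\<close> is regarded as obtained from
  \<open>rewrite \<tau> x\<close> by restoring the old contents at \<open>marks x\<close>. Thus
  \<open>\<tau>\<close> may be any self-map of \<open>W\<close>, even a constant one.\<close>

lemma marks_rewrite:
  assumes x: "x \<in> X" and \<tau>: "\<tau> \<in> W \<rightarrow> W"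
  shows "marks (rewrite \<tau> x) = marks x"
proof
  show mono: "marks x \<subseteq> marks (rewrite \<tau> x)"
    by (rule marks_mono[OF x subset_refl, of "\<lambda>g. \<tau> (pat g x)"])
       (use \<tau> pat_W[OF x] rewrite_on[OF x \<tau>] rewrite_off in auto)
  show "marks (rewrite \<tau> x) \<subseteq> marks x"
  proof (rule marks_mono[OF rewrite_in[OF x \<tau>] mono, of "\<lambda>g. pat g x"])
    show "pat g x \<in> W" if "g \<in> marks x" for g using pat_W[OF x that] .
    show "x (g \<otimes> b) = pat g x b" if "g \<in> marks x" "b \<in> B" for g b
      using that marks_carrier Bc by (simp add: pat_def)
    show "x k = rewrite \<tau> x k" if "k \<in> carrier G" "\<forall>g\<in>marks x. \<forall>b\<in>B. k \<noteq> g \<otimes> b" for k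
      using rewrite_off that by simp
  qed
qed

lemma pat_rewrite:
  assumes "x \<in> X" "\<tau> \<in> W \<rightarrow> W" "g \<in> marks x" "W \<subseteq> extensional B"
  shows "pat g (rewrite \<tau> x) = \<tau> (pat g x)"
proof
  fix b
  have "\<tau> (pat g x) \<in> extensional B" using assms pat_W by blast
  then show "pat g (rewrite \<tau> x) b = \<tau> (pat g x) b"
    using rewrite_on[OF assms(1-3)] marks_carrier[OF assms(3)] Bc
    by (cases "b \<in> B") (auto simp: pat_def extensional_def)
qed

lemma rewrite_rewrite:
  assumes x: "x \<in> X" and \<sigma>: "\<sigma> \<in> W \<rightarrow> W" and \<tau>: "\<tau> \<in> W \<rightarrow> W" and W: "W \<subseteq> extensional B"
    and \<rho>: "\<And>w. w \<in> W \<Longrightarrow> \<rho> w = \<tau> (\<sigma> w)"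
  shows "rewrite \<tau> (rewrite \<sigma> x) = rewrite \<rho> x"
proof -
  have \<rho>W: "\<rho> \<in> W \<rightarrow> W" using \<rho> \<sigma> \<tau> by auto
  have s: "rewrite \<sigma> x \<in> X" using rewrite_in[OF x \<sigma>] .
  show ?thesis
  proof (rule config_eqI[OF rewrite_in[OF s \<tau>] rewrite_in[OF x \<rho>W]])
    fix k assume k: "k \<in> carrier G"
    show "rewrite \<tau> (rewrite \<sigma> x) k = rewrite \<rho> x k"
    proof (cases "\<exists>g\<in>marks x. \<exists>b\<in>B. k = g \<otimes> b")
      case True
      then show ?thesis
        using rewrite_on[OF s \<tau>] rewrite_on[OF x \<rho>W] pat_rewrite[OF x \<sigma> _ W]
          marks_rewrite[OF x \<sigma>] \<rho> pat_W[OF x] by auto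
    next
      case False
      then show ?thesis
        using rewrite_off[OF k] marks_rewrite[OF x \<sigma>] by auto
    qed
  qed
qed

lemma rewrite_id:
  assumes x: "x \<in> X" and \<tau>: "\<And>w. w \<in> W \<Longrightarrow> \<tau> w = w"
  shows "rewrite \<tau> x = x"
proof -
  have \<tau>W: "\<tau> \<in> W \<rightarrow> W" using \<tau> by auto
  show ?thesis
  proof (rule config_eqI[OF rewrite_in[OF x \<tau>W] x])
    fix k assume k: "k \<in> carrier G"
    show "rewrite \<tau> x k = x k"
    proof (cases "\<exists>g\<in>marks x. \<exists>b\<in>B. k = g \<otimes> b")
      case True
      then obtain g b where g: "g \<in> marks x" "b \<in> B" "k = g \<otimes> b" by blast
      then show ?thesis
        using rewrite_on[OF x \<tau>W g(1,2)] \<tau> pat_W[OF x g(1)] marks_carrier[OF g(1)] Bc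
        by (simp add: pat_def)
    next
      case False
      then show ?thesis using rewrite_off[OF k] by auto
    qed
  qed
qed

lemma rewrite_shift:
  assumes x: "x \<in> X" and \<tau>: "\<tau> \<in> W \<rightarrow> W" and s: "s \<in> carrier G"
  shows "rewrite \<tau> (shift G s x) = shift G s (rewrite \<tau> x)"
proof -
  have sx: "shift G s x \<in> X" using shift_in x s by blast
  have sh: "shift G s y k = y (inv s \<otimes> k)" if "k \<in> carrier G" for y :: "'a \<Rightarrow> 'b" and k
    using that by (simp add: shift_def)
  have tr: "translate g (shift G s x) = translate (inv s \<otimes> g) x" if "g \<in> carrier G" for g
    by (rule config_eqI) (use that s sx x in \<open>auto simp: sh m_assoc\<close>)
  have m: "g \<in> marks (shift G s x) \<longleftrightarrow> inv s \<otimes> g \<in> marks x" if "g \<in> carrier G" for g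
    using that s tr by (simp add: marks_def)
  have p: "pat g (shift G s x) = pat (inv s \<otimes> g) x" if "g \<in> carrier G" for g
    using that tr by (simp add: pat_def)
  show ?thesis
  proof (rule config_eqI[OF rewrite_in[OF sx \<tau>] shift_in[OF s rewrite_in[OF x \<tau>]]])
    fix k assume k: "k \<in> carrier G"
    show "rewrite \<tau> (shift G s x) k = shift G s (rewrite \<tau> x) k"
    proof (cases "\<exists>g\<in>marks (shift G s x). \<exists>b\<in>B. k = g \<otimes> b")
      case True
      then obtain g b where g: "g \<in> marks (shift G s x)" "b \<in> B" "k = g \<otimes> b" by blast
      have gc: "g \<in> carrier G" using g marks_carrier by blast
      have "inv s \<otimes> k = (inv s \<otimes> g) \<otimes> b" using g gc s Bc by (simp add: m_assoc)
      then show ?thesis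
        using rewrite_on[OF sx \<tau> g(1,2)] rewrite_on[OF x \<tau> _ g(2), of "inv s \<otimes> g"] g gc m p sh[OF k]
        by simp
    next
      case False
      have "inv s \<otimes> k \<noteq> g \<otimes> b" if g: "g \<in> marks x" and b: "b \<in> B" for g b
      proof
        assume eq: "inv s \<otimes> k = g \<otimes> b"
        have gc: "g \<in> carrier G" using g marks_carrier by blast
        have "k = s \<otimes> g \<otimes> b" using eq k s gc b Bc
          by (metis inv_solve_left m_assoc m_closed)
        moreover have "s \<otimes> g \<in> marks (shift G s x)"
          using m[of "s \<otimes> g"] g gc s by (simp add: m_assoc[symmetric])
        ultimately show False using False b by blast
      qed
      then have "rewrite \<tau> x (inv s \<otimes> k) = x (inv s \<otimes> k)" using rewrite_off s k by blast
      then show ?thesis using rewrite_off[OF k, of "shift G s x"] False sh[OF k] by auto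
    qed
  qed
qed

text \<open>Any mark whose block contains \<open>k\<close> is \<open>k \<otimes> inv b\<close> for
  some \<open>b\<close>, and both its status and its content are decided on the finite set
  \<open>E\<close> around it.\<close>

lemma rewrite_local:
  assumes k: "k \<in> carrier G" and \<tau>: "\<tau> \<in> W \<rightarrow> W"
  shows "\<exists>F. finite F \<and> F \<subseteq> carrier G \<and>
    (\<forall>x\<in>X. \<forall>y\<in>X. (\<forall>j\<in>F. x j = y j) \<longrightarrow> rewrite \<tau> x k = rewrite \<tau> y k)"
proof -
  define E where "E = B \<union> T \<union> (\<lambda>(v, t). v \<otimes> t) ` (V \<times> T)"
  define F where "F = insert k ((\<lambda>(b, e). k \<otimes> inv b \<otimes> e) ` (B \<times> E))"
  have Ec: "E \<subseteq> carrier G" using Bc Tc V_carrier by (auto simp: E_def)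
  have "finite F" using B T finite_V by (auto simp: F_def E_def)
  moreover have "F \<subseteq> carrier G" using k Bc Ec by (auto simp: F_def)
  moreover have "rewrite \<tau> x k = rewrite \<tau> y k"
    if x: "x \<in> X" and y: "y \<in> X" and eq: "\<forall>j\<in>F. x j = y j" for x y
  proof -
    have loc: "g \<in> marks x \<longleftrightarrow> g \<in> marks y" "pat g x = pat g y"
      if g: "g \<in> carrier G" and b: "b \<in> B" "k = g \<otimes> b" for g b
    proof -
      have "k \<otimes> inv b = g" using b g Bc by (simp add: m_assoc)
      then have e: "translate g x e = translate g y e" if "e \<in> E" for e
        using eq that b(1) Ec g unfolding F_def by fastforce
      then show "pat g x = pat g y" by (auto simp: pat_def E_def)
      have "put (translate g x) w (v \<otimes> t) = put (translate g y) w (v \<otimes> t)"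
        if "v \<in> V" "t \<in> T" for w v t
        using e[of "v \<otimes> t"] that by (auto simp: put_def E_def)
      then have "marked (translate g x) \<longleftrightarrow> marked (translate g y)"
        unfolding marked_def using e by (auto simp: E_def)
      then show "g \<in> marks x \<longleftrightarrow> g \<in> marks y" by (simp add: marks_def)
    qed
    show ?thesis
    proof (cases "\<exists>g\<in>marks x. \<exists>b\<in>B. k = g \<otimes> b")
      case True
      then obtain g b where g: "g \<in> marks x" "b \<in> B" "k = g \<otimes> b" by blast
      note l = loc[OF marks_carrier[OF g(1)] g(2,3)]
      show ?thesis using rewrite_on[OF x \<tau> g(1,2)] rewrite_on[OF y \<tau> _ g(2), of g] l g by simp
    next
      case False
      then have "\<forall>g\<in>marks y. \<forall>b\<in>B. k \<noteq> g \<otimes> b" using loc(1) marks_carrier by blast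
      then show ?thesis using rewrite_off[OF k] False eq unfolding F_def by auto
    qed
  qed
  ultimately show ?thesis by blast
qed

end

text \<open>The easy half of the Curtis-Hedlund-Lyndon theorem; the window may depend on
  \<open>k\<close>, as equivariance is treated separately.\<close>

lemma (in subshift_space) continuous_map_local:
  assumes f: "\<And>x. x \<in> X \<Longrightarrow> f x \<in> X"
    and loc: "\<And>k. k \<in> carrier G \<Longrightarrow> \<exists>F. finite F \<and> F \<subseteq> carrier G \<and>
      (\<forall>x\<in>X. \<forall>y\<in>X. (\<forall>j\<in>F. x j = y j) \<longrightarrow> f x k = f y k)"
  shows "continuous_map (subtopology (prodiscrete G A) X) (subtopology (prodiscrete G A) X) f"
proof -
  let ?P = "prodiscrete G A"
  have sub: "X \<subseteq> carrier G \<rightarrow>\<^sub>E A" using config by blast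
  have top: "topspace (subtopology ?P X) = X"
    using sub by (auto simp: prodiscrete_def)
  have "continuous_map (subtopology ?P X) (discrete_topology A) (\<lambda>x. f x k)"
    if k: "k \<in> carrier G" for k
  proof -
    obtain F where F: "finite F" "F \<subseteq> carrier G"
      "\<forall>x\<in>X. \<forall>y\<in>X. (\<forall>j\<in>F. x j = y j) \<longrightarrow> f x k = f y k" using loc[OF k] by blast
    have "openin (subtopology ?P X) {x \<in> X. f x k \<in> U}" for U
    proof (subst openin_subopen, intro ballI)
      fix x assume x: "x \<in> {x \<in> X. f x k \<in> U}"
      define C where "C = Pi\<^sub>E (carrier G) (\<lambda>j. if j \<in> F then {x j} else A)"
      have "openin ?P C"
        unfolding prodiscrete_def C_def
      proof (rule product_topology_basis)
        show "openin (discrete_topology A) (if j \<in> F then {x j} else A)" for j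
          using x config[of x] F(2) by (auto dest: PiE_mem)
        show "finite {i. (if i \<in> F then {x i} else A) \<noteq> topspace (discrete_topology A)}"
          by (rule finite_subset[OF _ F(1)]) auto
      qed
      then have "openin (subtopology ?P X) (C \<inter> X)" by (auto simp: openin_subtopology)
      moreover have "x \<in> C \<inter> X" using x config[of x] by (auto simp: C_def PiE_iff)
      moreover have "C \<inter> X \<subseteq> {x \<in> X. f x k \<in> U}"
      proof
        fix y assume y: "y \<in> C \<inter> X"
        then have "\<forall>j\<in>carrier G. y j \<in> (if j \<in> F then {x j} else A)"
          unfolding C_def by (auto simp: PiE_iff)
        then have "\<forall>j\<in>F. y j = x j" using F(2) by fastforce
        then have "f y k = f x k" using F(3) y x by blast
        then show "y \<in> {x \<in> X. f x k \<in> U}" using x y by auto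
      qed
      ultimately show "\<exists>C. openin (subtopology ?P X) C \<and> x \<in> C \<and> C \<subseteq> {x \<in> X. f x k \<in> U}"
        by blast
    qed
    moreover have "f x k \<in> A" if "x \<in> X" for x
      using config[OF f[OF that]] k by auto
    ultimately show ?thesis unfolding continuous_map_def top by auto
  qed
  moreover have "f ` X \<subseteq> extensional (carrier G)" using f config by (auto simp: PiE_def)
  ultimately have "continuous_map (subtopology ?P X) ?P f"
    unfolding prodiscrete_def[of G A] continuous_map_componentwise
    unfolding prodiscrete_def[of G A, symmetric] top by blast
  then show ?thesis using f by (auto simp: continuous_map_in_subtopology)
qed

section \<open>Embedding finite groups by permuting block contents\<close>

context exchange
begin

lemma rewrite_automorphism:
  assumes \<tau>: "\<tau> \<in> W \<rightarrow> W" and \<tau>': "\<tau>' \<in> W \<rightarrow> W" and W: "W \<subseteq> extensional B"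
    and inv: "\<And>w. w \<in> W \<Longrightarrow> \<tau>' (\<tau> w) = w" "\<And>w. w \<in> W \<Longrightarrow> \<tau> (\<tau>' w) = w"
  shows "restrict (rewrite \<tau>) X \<in> subshift_auts G A X"
proof -
  let ?T = "subtopology (prodiscrete G A) X"
  have top: "topspace ?T = X" using config by (auto simp: prodiscrete_def)
  have rr: "rewrite \<tau>' (rewrite \<tau> x) = x" "rewrite \<tau> (rewrite \<tau>' x) = x" if "x \<in> X" for x
    using rewrite_rewrite[OF that \<tau> \<tau>' W, of "\<lambda>w. w"] rewrite_rewrite[OF that \<tau>' \<tau> W, of "\<lambda>w. w"]
      rewrite_id[OF that, of "\<lambda>w. w"] inv by auto
  have "continuous_map ?T ?T (rewrite \<rho>)" if "\<rho> \<in> W \<rightarrow> W" for \<rho>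
    by (rule continuous_map_local[OF rewrite_in[OF _ that] rewrite_local[OF _ that]])
  then have "homeomorphic_maps ?T ?T (rewrite \<tau>) (rewrite \<tau>')"
    unfolding homeomorphic_maps_def top using rr \<tau> \<tau>' by blast
  then have "homeomorphic_map ?T ?T (rewrite \<tau>)" using homeomorphic_maps_map by blast
  then have "homeomorphic_map ?T ?T (restrict (rewrite \<tau>) X)"
    by (rule homeomorphic_map_eq) (simp add: top)
  moreover have "bij_betw (rewrite \<tau>) X X"
    by (rule bij_betwI[of _ _ _ "rewrite \<tau>'"]) (use rewrite_in \<tau> \<tau>' rr in auto)
  then have "restrict (rewrite \<tau>) X \<in> Bij X" by (simp add: Bij_def)
  ultimately show ?thesis
    using rewrite_shift[OF _ \<tau>] shift_in by (auto simp: subshift_auts_def)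
qed

text \<open>Cayley's action: \<open>H\<close> acts by left multiplication on its copy in
  \<open>W\<close> and trivially on the remaining contents. Faithfulness is read off at a single
  mark.\<close>

lemma finite_group_embeds:
  fixes H :: "('h, 'n) monoid_scheme"
  assumes H: "group H" and \<iota>: "inj_on \<iota> (carrier H)" "\<iota> ` carrier H \<subseteq> W"
    and W: "W \<subseteq> extensional B" and marks: "x \<in> X" "marks x \<noteq> {}"
  shows "\<exists>\<phi>. \<phi> \<in> mon H (Aut_subshift G A X)"
proof -
  interpret H: group H by fact
  define act where "act h w = (if w \<in> \<iota> ` carrier H
    then \<iota> (h \<otimes>\<^bsub>H\<^esub> inv_into (carrier H) \<iota> w) else w)" for h w
  have act_\<iota>: "act h (\<iota> a) = \<iota> (h \<otimes>\<^bsub>H\<^esub> a)" if "a \<in> carrier H" for h a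
    using that \<iota>(1) by (simp add: act_def)
  have act_other: "act h w = w" if "w \<notin> \<iota> ` carrier H" for h w
    using that by (simp add: act_def)
  have act_W: "act h \<in> W \<rightarrow> W" if h: "h \<in> carrier H" for h
  proof
    fix w assume "w \<in> W"
    then show "act h w \<in> W"
      using act_other[of w h] act_\<iota>[of _ h] h \<iota>(2) by (cases "w \<in> \<iota> ` carrier H") fastforce+
  qed
  have act_mult: "act (g \<otimes>\<^bsub>H\<^esub> h) w = act g (act h w)" if "g \<in> carrier H" "h \<in> carrier H" for g h w
  proof (cases "w \<in> \<iota> ` carrier H")
    case True
    then obtain a where "a \<in> carrier H" "w = \<iota> a" by blast
    then show ?thesis using that by (simp add: act_\<iota> H.m_assoc)
  next
    case False
    then show ?thesis by (simp add: act_other)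
  qed
  have act_one: "act \<one>\<^bsub>H\<^esub> w = w" for w
    using act_\<iota> act_other by (cases "w \<in> \<iota> ` carrier H") auto
  define \<phi> where "\<phi> h = restrict (rewrite (act h)) X" for h
  have aut: "\<phi> h \<in> subshift_auts G A X" if h: "h \<in> carrier H" for h
    unfolding \<phi>_def
  proof (rule rewrite_automorphism[OF act_W[OF h] act_W[OF H.inv_closed[OF h]] W])
    show "act (inv\<^bsub>H\<^esub> h) (act h w) = w" "act h (act (inv\<^bsub>H\<^esub> h) w) = w" for w
      using h act_mult[symmetric] act_one by auto
  qed
  have "\<phi> (g \<otimes>\<^bsub>H\<^esub> h) = \<phi> g \<otimes>\<^bsub>BijGroup X\<^esub> \<phi> h" if g: "g \<in> carrier H" and h: "h \<in> carrier H" for g h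
  proof -
    have "rewrite (act g) (rewrite (act h) y) = rewrite (act (g \<otimes>\<^bsub>H\<^esub> h)) y" if "y \<in> X" for y
      by (rule rewrite_rewrite[OF that act_W[OF h] act_W[OF g] W]) (rule act_mult[OF g h])
    moreover have "\<phi> g \<in> Bij X" "\<phi> h \<in> Bij X" using aut g h by (auto simp: subshift_auts_def)
    ultimately show ?thesis
      using rewrite_in[OF _ act_W[OF h]] by (auto simp: BijGroup_def compose_def \<phi>_def)
  qed
  then have hom: "\<phi> \<in> hom H (Aut_subshift G A X)"
    using aut by (auto simp: hom_def Aut_subshift_def)
  have "inj_on \<phi> (carrier H)"
  proof (rule inj_onI)
    fix g h assume g: "g \<in> carrier H" and h: "h \<in> carrier H" and eq: "\<phi> g = \<phi> h"
    obtain m where m: "m \<in> marks x" using marks by blast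
    have one: "\<one>\<^bsub>H\<^esub> \<in> carrier H" by simp
    have const: "(\<lambda>_. \<iota> \<one>\<^bsub>H\<^esub>) \<in> W \<rightarrow> W" using \<iota>(2) one by blast
    \<comment> \<open>A constant rewriting plants the identity of \<open>H\<close> at every mark;
      \<open>\<phi> a\<close> turns it into \<open>\<iota> a\<close>, which reveals
      \<open>a\<close>.\<close>
    define y where "y = rewrite (\<lambda>_. \<iota> \<one>\<^bsub>H\<^esub>) x"
    have y: "y \<in> X" "m \<in> marks y" "pat m y = \<iota> \<one>\<^bsub>H\<^esub>"
      using rewrite_in[OF marks(1) const] marks_rewrite[OF marks(1) const]
        pat_rewrite[OF marks(1) const m W] m by (auto simp: y_def)
    have "pat m (\<phi> a y) = \<iota> a" if "a \<in> carrier H" for a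
      using pat_rewrite[OF y(1) act_W[OF that] y(2) W] y act_\<iota>[OF one] that by (simp add: \<phi>_def)
    then show "g = h" using eq g h \<iota>(1) by (metis inj_onD)
  qed
  then show ?thesis using hom by (auto simp: mon_def)
qed

end

section \<open>Generic positions in strongly irreducible subshifts\<close>

locale si_subshift = subshift_space G A X
  for G (structure) and A :: "'b set" and X :: "('a \<Rightarrow> 'b) set" +
  fixes K :: "'a set" and \<alpha> \<beta> :: "'a \<Rightarrow> 'b"
  assumes infinite_group: "infinite (carrier G)" and finite_alphabet: "finite A"
    and K: "finite K" "K \<subseteq> carrier G" "\<one> \<in> K" "\<And>k. k \<in> K \<Longrightarrow> inv k \<in> K"
    and glue: "\<And>S T x y. finite S \<Longrightarrow> S \<subseteq> carrier G \<Longrightarrow> finite T \<Longrightarrow> T \<subseteq> carrier G \<Longrightarrow>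
      \<forall>s\<in>S. \<forall>k\<in>K. s \<otimes> k \<notin> T \<Longrightarrow> x \<in> X \<Longrightarrow> y \<in> X \<Longrightarrow>
      \<exists>z\<in>X. (\<forall>s\<in>S. z s = x s) \<and> (\<forall>t\<in>T. z t = y t)"
    and letters: "\<alpha> \<in> X" "\<beta> \<in> X" "\<alpha> \<one> \<noteq> \<beta> \<one>"
begin

section \<open>Witnesses against elements outside the kernel\<close>

lemma Kc: "k \<in> K \<Longrightarrow> k \<in> carrier G"
  using K by auto

lemma value_at:
  assumes "x \<in> X" "g \<in> carrier G"
  shows "\<exists>z\<in>X. z g = x \<one>"
  using assms by (intro bexI[of _ "translate (inv g) x"]) auto

lemma generic_element:
  assumes "finite Z"
  obtains r where "r \<in> carrier G" "r \<notin> Z"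
  using infinite_group assms by (meson finite_subset subsetI)

lemma distinguished:
  assumes "s \<in> carrier G" "s \<notin> K"
  shows "\<exists>z\<in>X. z \<one> \<noteq> z s"
proof -
  obtain b where b: "b \<in> X" "b s = \<beta> \<one>" using value_at letters assms by blast
  have "\<exists>z\<in>X. (\<forall>t\<in>{\<one>}. z t = \<alpha> t) \<and> (\<forall>t\<in>{s}. z t = b t)"
    by (rule glue) (use assms letters b Kc in auto)
  then obtain z where "z \<in> X" "z \<one> = \<alpha> \<one>" "z s = b s" by auto
  then show ?thesis using b letters by (intro bexI[of _ z]) auto
qed

lemma finite_kernel: "finite kernel_of_action"
proof -
  have "kernel_of_action \<subseteq> K"
  proof
    fix n assume n: "n \<in> kernel_of_action"
    have "z \<one> = z n" if "z \<in> X" for z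
      using kernel_apply[OF n that, of \<one>] kernel_carrier[OF n] by simp
    then show "n \<in> K" using distinguished[OF kernel_carrier[OF n]] by blast
  qed
  then show ?thesis using K finite_subset by blast
qed

text \<open>Outside \<open>K\<close> the identity position always serves, by
  \<open>distinguished\<close>; the finitely many remaining elements need one position each. Only
  the positions are uniform, not the configurations.\<close>

lemma uniform_witnesses:
  obtains D where "finite D" "D \<subseteq> carrier G"
    "\<And>s. s \<in> carrier G - kernel_of_action \<Longrightarrow> \<exists>t\<in>D. \<exists>x\<in>X. x t \<noteq> x (s \<otimes> t)"
proof -
  have "\<forall>s\<in>K - kernel_of_action. \<exists>t. t \<in> carrier G \<and> (\<exists>x\<in>X. x t \<noteq> x (s \<otimes> t))"
    using Kc by (auto simp: kernel_of_action_def) metis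
  then obtain f where f: "\<forall>s\<in>K - kernel_of_action. f s \<in> carrier G \<and> (\<exists>x\<in>X. x (f s) \<noteq> x (s \<otimes> f s))"
    by metis
  show ?thesis
  proof (rule that[of "insert \<one> (f ` (K - kernel_of_action))"])
    fix s assume s: "s \<in> carrier G - kernel_of_action"
    show "\<exists>t\<in>insert \<one> (f ` (K - kernel_of_action)). \<exists>x\<in>X. x t \<noteq> x (s \<otimes> t)"
    proof (cases "s \<in> K")
      case True
      then show ?thesis using f s by blast
    next
      case False
      then show ?thesis using distinguished[of s] s by auto
    qed
  qed (use K f in auto)
qed

text \<open>A conjugate of \<open>e\<close> by \<open>r\<close> is again outside the kernel and has
  a witness \<open>t\<close> in a finite set \<open>D\<close> fixed before \<open>r\<close>.
  Translating back gives the witness \<open>r \<otimes> t\<close> for \<open>e\<close>, and a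
  generic \<open>r\<close> moves all candidates off the forbidden set.\<close>

lemma generic_witness:
  assumes e: "e \<in> carrier G - kernel_of_action" and Z: "finite Z"
  obtains \<rho> x where "\<rho> \<in> carrier G" "\<rho> \<notin> Z" "e \<otimes> \<rho> \<notin> Z" "x \<in> X" "x \<rho> \<noteq> x (e \<otimes> \<rho>)"
proof -
  obtain D where D: "finite D" "D \<subseteq> carrier G"
    "\<And>s. s \<in> carrier G - kernel_of_action \<Longrightarrow> \<exists>t\<in>D. \<exists>x\<in>X. x t \<noteq> x (s \<otimes> t)"
    using uniform_witnesses by blast
  define Z' where "Z' = Z \<union> (\<lambda>z. inv e \<otimes> z) ` Z"
  obtain r where r: "r \<in> carrier G" "r \<notin> (\<lambda>(z, t). z \<otimes> inv t) ` (Z' \<times> D)"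
    using generic_element[of "(\<lambda>(z, t). z \<otimes> inv t) ` (Z' \<times> D)"] Z D(1) Z'_def by auto
  have "inv r \<otimes> e \<otimes> r \<in> carrier G - kernel_of_action"
    using kernel_conj[of r e] r e by auto
  then obtain t x where t: "t \<in> D" "x \<in> X" "x t \<noteq> x (inv r \<otimes> e \<otimes> r \<otimes> t)" using D(3) by blast
  have tc: "t \<in> carrier G" using t D by auto
  have avoid: "r \<otimes> t \<notin> Z'"
  proof
    assume "r \<otimes> t \<in> Z'"
    moreover have "r = r \<otimes> t \<otimes> inv t" using r tc by (simp add: m_assoc)
    ultimately show False using r(2) t(1) by (metis (no_types, lifting) case_prod_conv image_eqI mem_Sigma_iff)
  qed
  show ?thesis
  proof (rule that[of "r \<otimes> t" "translate (inv r) x"])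
    show "r \<otimes> t \<notin> Z" using avoid Z'_def by auto
    show "e \<otimes> (r \<otimes> t) \<notin> Z"
    proof
      assume "e \<otimes> (r \<otimes> t) \<in> Z"
      then have "inv e \<otimes> (e \<otimes> (r \<otimes> t)) \<in> Z'" unfolding Z'_def by blast
      then show False using avoid e r tc by (simp add: m_assoc[symmetric])
    qed
    show "translate (inv r) x (r \<otimes> t) \<noteq> translate (inv r) x (e \<otimes> (r \<otimes> t))"
      using t(3) r e tc by (simp add: m_assoc) (simp add: m_assoc[symmetric])
  qed (use r tc t in auto)
qed

section \<open>Separated sets, free bits and witness sets\<close>

definition separated :: "'a set \<Rightarrow> bool" where
  "separated Q \<longleftrightarrow> (\<forall>p\<in>Q. \<forall>q\<in>Q. \<forall>k\<in>K. \<forall>l\<in>K. p \<otimes> k = q \<otimes> l \<longrightarrow> p = q)"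

lemma solve_right:
  assumes "a \<in> carrier G" "b \<in> carrier G" "c \<in> carrier G"
  shows "a \<otimes> b = c \<longleftrightarrow> a = c \<otimes> inv b"
  using assms inv_solve_right[of a c b] by auto

lemma separated_set:
  assumes "finite Z"
  shows "\<exists>Q. finite Q \<and> Q \<subseteq> carrier G \<and> card Q = m \<and> Q \<inter> Z = {} \<and> separated Q"
proof (induction m)
  case 0
  then show ?case by (intro exI[of _ "{}"]) (auto simp: separated_def)
next
  case (Suc m)
  then obtain Q where Q: "finite Q" "Q \<subseteq> carrier G" "card Q = m" "Q \<inter> Z = {}" "separated Q" by blast
  define Z' where "Z' = Z \<union> (\<lambda>(q, k, l). q \<otimes> k \<otimes> inv l) ` (Q \<times> K \<times> K)"
  obtain r where r: "r \<in> carrier G" "r \<notin> Z'"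
    using generic_element[of Z'] assms Q(1) K(1) Z'_def by auto
  have far: "r \<otimes> k \<noteq> q \<otimes> l" if "q \<in> Q" "k \<in> K" "l \<in> K" for q k l
  proof
    assume "r \<otimes> k = q \<otimes> l"
    then have "r = q \<otimes> l \<otimes> inv k" using solve_right[of r k "q \<otimes> l"] r that Q Kc by auto
    then show False using r(2) that unfolding Z'_def by force
  qed
  have "r \<notin> Q" using far[of r \<one> \<one>] K by auto
  moreover have "separated (insert r Q)"
    using Q(5) far far[symmetric] unfolding separated_def by blast
  ultimately show ?case using Q r Z'_def by (intro exI[of _ "insert r Q"]) auto
qed

lemma bits:
  assumes "finite Q" "Q \<subseteq> carrier G" "separated Q"
  shows "\<exists>x\<in>X. \<forall>q\<in>Q. x q = (if q \<in> U then \<alpha> \<one> else \<beta> \<one>)"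
  using assms
proof (induction Q rule: finite_induct)
  case empty
  then show ?case using letters by blast
next
  case (insert p Q)
  then have "separated Q" by (auto simp: separated_def)
  then obtain x where x: "x \<in> X" "\<forall>q\<in>Q. x q = (if q \<in> U then \<alpha> \<one> else \<beta> \<one>)"
    using insert by auto
  obtain y where y: "y \<in> X" "y p = (if p \<in> U then \<alpha> \<one> else \<beta> \<one>)"
    using value_at[OF letters(1), of p] value_at[OF letters(2), of p] insert.prems
    by (cases "p \<in> U") auto
  have "\<forall>s\<in>{p}. \<forall>k\<in>K. s \<otimes> k \<notin> Q"
  proof (intro ballI notI)
    fix s k assume s: "s \<in> {p}" "k \<in> K" "s \<otimes> k \<in> Q"
    then have "s \<otimes> k = (s \<otimes> k) \<otimes> \<one>" using insert.prems by auto
    then have "p = p \<otimes> k"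
      using insert.prems(2) s K(3) unfolding separated_def by blast
    then show False using s insert.hyps by auto
  qed
  then have "\<exists>z\<in>X. (\<forall>s\<in>{p}. z s = y s) \<and> (\<forall>t\<in>Q. z t = x t)"
    by (intro glue) (use insert x y in auto)
  then show ?case using x y by auto
qed

text \<open>Points of \<open>Q\<close> lost to the later count: \<open>h\<close> brings them within
  \<open>K\<close> of the witnesses \<open>R\<close>, where agreement with \<open>y\<close> cannot
  be arranged by gluing.\<close>

definition hits :: "'a set \<Rightarrow> 'a set \<Rightarrow> 'a \<Rightarrow> 'a set" where
  "hits Q R h = {q \<in> Q. \<exists>r\<in>R. \<exists>k\<in>K. h \<otimes> q = r \<otimes> k}"

lemma hits_single:
  assumes Q: "finite Q" "Q \<subseteq> carrier G" "separated Q" and c: "h \<in> carrier G" "r \<in> carrier G"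
  shows "card (hits Q {r} h) \<le> 1"
proof -
  have "p = q" if p: "p \<in> hits Q {r} h" and q: "q \<in> hits Q {r} h" for p q
  proof -
    obtain k l where kl: "k \<in> K" "h \<otimes> p = r \<otimes> k" "l \<in> K" "h \<otimes> q = r \<otimes> l" "p \<in> Q" "q \<in> Q"
      using p q by (auto simp: hits_def)
    then have pq: "p \<in> carrier G" "q \<in> carrier G" using Q by auto
    have "h \<otimes> (p \<otimes> inv k) = r" "h \<otimes> (q \<otimes> inv l) = r"
      using kl c pq Kc by (simp_all add: m_assoc[symmetric]) (simp_all add: m_assoc)
    then have "p \<otimes> inv k = q \<otimes> inv l"
      using c pq kl Kc by (metis inv_closed Units_l_cancel Units_eq m_closed)
    then show "p = q" using Q(3) kl K(4) unfolding separated_def by blast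
  qed
  moreover have "finite (hits Q {r} h)" using Q by (simp add: hits_def)
  ultimately show ?thesis by (auto simp: card_le_Suc0_iff_eq)
qed

text \<open>
  The witnesses for \<open>e\<close> are a pair \<open>\<rho>\<close>, \<open>e \<otimes> \<rho>\<close>. When they are chosen generically, no translate of \<open>Q\<close>
  comes near two different pairs, and each of the two points of a pair is hit at most once.
\<close>

lemma witness_set:
  assumes Q: "finite Q" "Q \<subseteq> carrier G" "separated Q" and Z: "finite Z"
    and E: "finite E" "E \<subseteq> carrier G - kernel_of_action"
  shows "\<exists>R \<xi>. finite R \<and> R \<subseteq> carrier G \<and> R \<inter> Z = {} \<and> card R \<le> 2 * card E \<and> \<xi> \<in> X \<and>
    (\<forall>e\<in>E. \<exists>t\<in>R. e \<otimes> t \<in> R \<and> \<xi> t \<noteq> \<xi> (e \<otimes> t)) \<and>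
    (\<forall>h\<in>carrier G. card (hits Q R h) \<le> 2)"
  using E
proof (induction E rule: finite_induct)
  case empty
  then show ?case using letters by (intro exI[of _ "{}"] exI[of _ \<alpha>]) (auto simp: hits_def)
next
  case (insert e E)
  then obtain R \<xi> where R: "finite R" "R \<subseteq> carrier G" "R \<inter> Z = {}" "card R \<le> 2 * card E" "\<xi> \<in> X"
    "\<forall>e\<in>E. \<exists>t\<in>R. e \<otimes> t \<in> R \<and> \<xi> t \<noteq> \<xi> (e \<otimes> t)" "\<forall>h\<in>carrier G. card (hits Q R h) \<le> 2"
    by auto
  \<comment> \<open>Avoiding \<open>r \<otimes> k\<close> permits gluing the new pair to
    \<open>R\<close>. Avoiding the five-fold products stops a translate of \<open>Q\<close> from
    coming near both the old witnesses and a new one: \<open>h \<otimes> p = r \<otimes> k\<close>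
    and \<open>h \<otimes> q = s \<otimes> l\<close> would force \<open>s\<close> to be such a
    product.\<close>
  define Z' where "Z' = Z \<union> (\<lambda>(r, k). r \<otimes> k) ` (R \<times> K) \<union>
    (\<lambda>(r, k, p, q, l). r \<otimes> k \<otimes> inv p \<otimes> q \<otimes> inv l) ` (R \<times> K \<times> Q \<times> Q \<times> K)"
  have "finite Z'" using Z R(1) K(1) Q(1) by (auto simp: Z'_def)
  then obtain \<rho> x where \<rho>: "\<rho> \<in> carrier G" "\<rho> \<notin> Z'" "e \<otimes> \<rho> \<notin> Z'" "x \<in> X" "x \<rho> \<noteq> x (e \<otimes> \<rho>)"
    using generic_witness[of e Z'] insert.prems by blast
  have ec: "e \<in> carrier G" using insert.prems by auto
  have "\<exists>z\<in>X. (\<forall>s\<in>R. z s = \<xi> s) \<and> (\<forall>t\<in>{\<rho>, e \<otimes> \<rho>}. z t = x t)"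
  proof (rule glue)
    show "\<forall>s\<in>R. \<forall>k\<in>K. s \<otimes> k \<notin> {\<rho>, e \<otimes> \<rho>}"
    proof (intro ballI notI)
      fix s k assume "s \<in> R" "k \<in> K" and sk: "s \<otimes> k \<in> {\<rho>, e \<otimes> \<rho>}"
      then have "s \<otimes> k \<in> (\<lambda>(r, k). r \<otimes> k) ` (R \<times> K)" by (intro image_eqI[of _ _ "(s, k)"]) auto
      then show False using sk \<rho>(2,3) unfolding Z'_def by auto
    qed
  qed (use R \<rho> ec in auto)
  then obtain z where z: "z \<in> X" "\<forall>s\<in>R. z s = \<xi> s" "z \<rho> = x \<rho>" "z (e \<otimes> \<rho>) = x (e \<otimes> \<rho>)" by auto
  define R' where "R' = insert \<rho> (insert (e \<otimes> \<rho>) R)"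
  have "card (hits Q R' h) \<le> 2" if h: "h \<in> carrier G" for h
  proof (cases "hits Q R h = {}")
    case True
    then have "hits Q R' h = hits Q {\<rho>} h \<union> hits Q {e \<otimes> \<rho>} h"
      unfolding hits_def R'_def by blast
    moreover have "card (hits Q {\<rho>} h) \<le> 1" "card (hits Q {e \<otimes> \<rho>} h) \<le> 1"
      using hits_single[OF Q h] \<rho> ec by auto
    ultimately show ?thesis using card_Un_le[of "hits Q {\<rho>} h" "hits Q {e \<otimes> \<rho>} h"] by simp
  next
    case False
    then obtain p r k where p: "p \<in> Q" "r \<in> R" "k \<in> K" "h \<otimes> p = r \<otimes> k" by (auto simp: hits_def)
    have c: "p \<in> carrier G" "r \<in> carrier G" "k \<in> carrier G" using p Q R Kc by auto
    then have h_eq: "h = r \<otimes> k \<otimes> inv p" using solve_right[of h p "r \<otimes> k"] p h by auto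
    have none: "h \<otimes> q \<noteq> s \<otimes> l" if s: "s \<in> carrier G" "s \<notin> Z'" and q: "q \<in> Q" "l \<in> K" for s q l
    proof
      assume "h \<otimes> q = s \<otimes> l"
      then have "s = r \<otimes> k \<otimes> inv p \<otimes> q \<otimes> inv l"
        using solve_right[of s l "h \<otimes> q"] h_eq s q Q Kc h by auto
      then have "s \<in> Z'" using p q unfolding Z'_def by (intro UnI2 image_eqI[of _ _ "(r,k,p,q,l)"]) auto
      then show False using s by blast
    qed
    have "hits Q R' h = hits Q R h"
      using none[of \<rho>] none[of "e \<otimes> \<rho>"] \<rho> ec unfolding hits_def R'_def by auto
    then show ?thesis using R(7) h by auto
  qed
  moreover have "card R' \<le> 2 * card (insert e E)"
    using R(1,4) insert.hyps card_insert_le_m1 unfolding R'_def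
    by (simp add: card_insert_if)
  moreover have "\<forall>f\<in>insert e E. \<exists>t\<in>R'. f \<otimes> t \<in> R' \<and> z t \<noteq> z (f \<otimes> t)"
  proof
    fix f assume "f \<in> insert e E"
    then show "\<exists>t\<in>R'. f \<otimes> t \<in> R' \<and> z t \<noteq> z (f \<otimes> t)"
    proof
      assume "f = e"
      then show ?thesis using z \<rho> unfolding R'_def by auto
    next
      assume "f \<in> E"
      then obtain t where "t \<in> R" "f \<otimes> t \<in> R" "\<xi> t \<noteq> \<xi> (f \<otimes> t)" using R(6) by blast
      then show ?thesis using z(2) unfolding R'_def by auto
    qed
  qed
  moreover have "finite R'" "R' \<subseteq> carrier G" "R' \<inter> Z = {}"
    using R \<rho> ec by (auto simp: R'_def Z'_def)
  ultimately show ?case using z(1) by blast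
qed

text \<open>Here \<open>b\<close>, \<open>t\<close>, \<open>k\<close> stand for the sizes of
  \<open>B\<close>, \<open>T\<close>, \<open>K\<close>, and \<open>m\<close> for that of
  \<open>Q\<close>. The term \<open>m * m * k + b * m\<close> bounds the number of displacements
  needing witnesses, the squared sum bounds the pairs from \<open>B \<union> T'\<close>, and 4
  counts the bit patterns compatible with one displacement.\<close>

lemma polynomial_less_exponential:
  "\<exists>m. 4 * (b * b * (b + t + m + 2 * (m * m * k + b * m))^2) < (2::nat) ^ m"
proof -
  \<comment> \<open>The left-hand side at \<open>m = 1\<close>; each summand inside the square grows
    at most by the factor \<open>m * m\<close>, so the whole grows at most by
    \<open>m ^ 4\<close>.\<close>
  define D where "D = 4 * (b * b * (b + t + 1 + 2 * (k + b))^2)"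
  have "(\<lambda>m::nat. real m ^ 4 / 2 ^ m) \<longlonglongrightarrow> 0"
    by real_asymp
  then have "\<forall>\<^sub>F m in sequentially. real m ^ 4 / 2 ^ m < 1 / (real D + 1)"
    by (rule order_tendstoD) simp
  then have "\<forall>\<^sub>F m in sequentially. real m ^ 4 / 2 ^ m < 1 / (real D + 1) \<and> m \<ge> 1"
    using eventually_ge_at_top by (rule eventually_conj)
  then obtain m :: nat where m: "real m ^ 4 / 2 ^ m < 1 / (real D + 1)" "m \<ge> 1"
    by (auto simp: eventually_sequentially)
  have "real ((D + 1) * m ^ 4) < real (2 ^ m)"
    using m(1) by (simp add: divide_simps mult.commute) argo
  then have D: "D * m ^ 4 < 2 ^ m"
    by (simp only: of_nat_less_iff) simp
  have "b + t + m + 2 * (m * m * k + b * m) \<le> (b + t + 1 + 2 * (k + b)) * (m * m)"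
  proof -
    have m: "1 \<le> m * m" "m \<le> m * m" using m(2) by auto
    have "b + t + m + 2 * (m * m * k + b * m) \<le>
        b * (m * m) + t * (m * m) + m * m + 2 * (m * m * k + b * (m * m))"
      by (intro add_mono mult_le_mono2) (use m in auto)
    then show ?thesis by (simp add: algebra_simps)
  qed
  then have "4 * (b * b * (b + t + m + 2 * (m * m * k + b * m))^2) \<le>
      4 * (b * b * ((b + t + 1 + 2 * (k + b)) * (m * m))^2)"
    by (intro mult_le_mono2 power_mono) auto
  also have "\<dots> = D * m ^ 4"
    by (simp add: D_def power_mult_distrib power2_eq_square power4_eq_xxxx algebra_simps)
  finally show ?thesis using D le_less_trans by blast
qed

lemma card_image_Times:
  assumes "finite P" "finite Q"
  shows "card (f ` (P \<times> Q)) \<le> card P * card Q"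
  using card_image_le[of "P \<times> Q" f] assms by (simp add: card_cartesian_product)

text \<open>
  \<open>T'\<close> adds to \<open>T\<close> a large separated set \<open>Q\<close> of \<open>m\<close> points carrying arbitrary bits, and a witness set \<open>R\<close>
  for the finitely many \<open>h\<close> that map a point of \<open>Q\<close> near \<open>Q\<close> or into \<open>B\<close>. Any other \<open>h\<close> maps all but
  two points of \<open>Q\<close> to places where \<open>x\<close> equals the fixed \<open>y\<close>, so at most four of the \<open>2 ^ m\<close> bit patterns
  \<open>U\<close> are reproduced by \<open>h\<close>; the number of \<open>h\<close> to consider is only polynomial in \<open>m\<close>.
\<close>

lemma isolated_occurrence:
  assumes B: "finite B" "B \<subseteq> carrier G" and T: "finite T" "T \<subseteq> carrier G" "T \<inter> B = {}"
    and y: "y \<in> X"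
  shows "\<exists>T' x. finite T' \<and> T \<subseteq> T' \<and> T' \<subseteq> carrier G \<and> T' \<inter> B = {} \<and> x \<in> X \<and> (\<forall>t\<in>T. x t = y t) \<and>
    (\<forall>h\<in>(\<lambda>(b, d, d', b'). b \<otimes> inv d \<otimes> (d' \<otimes> inv b')) ` (B \<times> (B \<union> T') \<times> (B \<union> T') \<times> B) -
        kernel_of_action.
      \<exists>t\<in>T'. h \<otimes> t \<notin> B \<and> x (h \<otimes> t) \<noteq> x t)"
proof -
  obtain m where m: "4 * (card B * card B * (card B + card T + m +
      2 * (m * m * card K + card B * m))^2) < 2 ^ m"
    using polynomial_less_exponential by blast
  have Bc: "\<And>b. b \<in> B \<Longrightarrow> b \<in> carrier G" using B by auto
  \<comment> \<open>Keeping \<open>Q\<close> and \<open>R\<close> off this set leaves the values of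
    \<open>y\<close> on \<open>T\<close> gluable with whatever is prescribed on \<open>Q\<close> and
    \<open>R\<close>.\<close>
  define TK where "TK = (\<lambda>(t, k). t \<otimes> inv k) ` (T \<times> K)"
  have TK: "finite TK" using T K by (simp add: TK_def)
  have near_T: "s \<otimes> k \<notin> T" if "s \<in> carrier G" "s \<notin> TK" "k \<in> K" for s k
  proof
    assume "s \<otimes> k \<in> T"
    moreover have "s = s \<otimes> k \<otimes> inv k" using that Kc by (simp add: m_assoc)
    ultimately show False using that unfolding TK_def by force
  qed
  obtain Q where Q: "finite Q" "Q \<subseteq> carrier G" "card Q = m" "Q \<inter> (B \<union> TK) = {}" "separated Q"
    using separated_set[of "B \<union> TK" m] B TK by blast
  define QK where "QK = (\<lambda>(q, k). q \<otimes> k) ` (Q \<times> K)"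
  have QK: "finite QK" using Q K by (simp add: QK_def)
  define E where "E = ((\<lambda>((p, q), k). p \<otimes> k \<otimes> inv q) ` ((Q \<times> Q) \<times> K) \<union>
    (\<lambda>(b, q). b \<otimes> inv q) ` (B \<times> Q)) - kernel_of_action"
  have E: "finite E" "E \<subseteq> carrier G - kernel_of_action"
    using Q(1,2) K(1) Kc B by (auto simp: E_def subset_iff)
  have "card E \<le> card ((\<lambda>((p, q), k). p \<otimes> k \<otimes> inv q) ` ((Q \<times> Q) \<times> K) \<union> (\<lambda>(b, q). b \<otimes> inv q) ` (B \<times> Q))"
    unfolding E_def by (rule card_mono) (use Q K B in auto)
  also have "\<dots> \<le> card (Q \<times> Q) * card K + card B * card Q"
    by (rule order_trans[OF card_Un_le add_mono]; rule card_image_Times) (use Q K B in auto)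
  finally have cardE: "card E \<le> m * m * card K + card B * m"
    using Q by (simp add: card_cartesian_product)
  obtain R \<xi> where R: "finite R" "R \<subseteq> carrier G" "R \<inter> (B \<union> TK \<union> QK) = {}" "card R \<le> 2 * card E" "\<xi> \<in> X"
    "\<forall>e\<in>E. \<exists>t\<in>R. e \<otimes> t \<in> R \<and> \<xi> t \<noteq> \<xi> (e \<otimes> t)" "\<forall>h\<in>carrier G. card (hits Q R h) \<le> 2"
    using witness_set[OF Q(1,2,5) _ E, of "B \<union> TK \<union> QK"] B TK QK by auto
  define T' where "T' = T \<union> Q \<union> R"
  have T': "finite T'" "T' \<subseteq> carrier G" "T' \<inter> B = {}" using T Q R by (auto simp: T'_def)
  define V where "V = (\<lambda>((b, b'), (d, d')). b \<otimes> inv d \<otimes> (d' \<otimes> inv b')) `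
    ((B \<times> B) \<times> ((B \<union> T') \<times> (B \<union> T')))"
  have V: "finite V" using B T' by (simp add: V_def)
  have Vc: "V \<subseteq> carrier G" unfolding V_def using Bc T' by (auto simp: subset_iff)
  have "card T' \<le> card T + card Q + card R"
    unfolding T'_def by (meson card_Un_le add_mono order_trans order_refl)
  then have "card (B \<union> T') \<le> card B + card T + m + 2 * (m * m * card K + card B * m)"
  proof -
    have "card (B \<union> T') \<le> card B + (card T + m + 2 * card E)"
      using card_Un_le[of B T'] R(4) Q(3) \<open>card T' \<le> _\<close> by linarith
    then show ?thesis using mult_le_mono2[OF cardE, of 2] by simp
  qed
  then have "card (B \<union> T') * card (B \<union> T') \<le>
      (card B + card T + m + 2 * (m * m * card K + card B * m))^2"
    unfolding power2_eq_square by (intro mult_mono) auto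
  moreover have "card V \<le> card (B \<times> B) * card ((B \<union> T') \<times> (B \<union> T'))"
    unfolding V_def by (rule card_image_Times) (use B T' in auto)
  ultimately have cardV: "4 * card V < 2 ^ m"
    using m by (simp add: card_cartesian_product) (smt (verit) mult_le_mono2 order_trans le_less_trans mult_le_mono)
  \<comment> \<open>A bit pattern is bad for \<open>h\<close> if, at all points not hit, it agrees
    with what \<open>y\<close> shows at their images. It is then determined by its trace on at most
    two hit points, which leaves at most \<open>2 ^ 2\<close> of them.\<close>
  define Bad where "Bad h = {U \<in> Pow Q. \<forall>q\<in>Q - hits Q R h. q \<in> U \<longleftrightarrow> y (h \<otimes> q) = \<alpha> \<one>}" for h
  have "card (Bad h) \<le> 4" if h: "h \<in> V" for h
  proof -
    have "inj_on (\<lambda>U. U \<inter> hits Q R h) (Bad h)"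
    proof (rule inj_onI)
      fix U U' assume U: "U \<in> Bad h" "U' \<in> Bad h" and eq: "U \<inter> hits Q R h = U' \<inter> hits Q R h"
      show "U = U'"
      proof (rule Set.set_eqI)
        fix q
        show "q \<in> U \<longleftrightarrow> q \<in> U'"
        proof (cases "q \<in> Q - hits Q R h")
          case True
          then show ?thesis using U unfolding Bad_def by blast
        next
          case False
          then show ?thesis using U eq unfolding Bad_def by blast
        qed
      qed
    qed
    moreover have "(\<lambda>U. U \<inter> hits Q R h) ` Bad h \<subseteq> Pow (hits Q R h)" by blast
    moreover have fin: "finite (hits Q R h)" using Q by (simp add: hits_def)
    ultimately have "card (Bad h) \<le> card (Pow (hits Q R h))"
      by (meson card_inj_on_le finite_Pow_iff)
    also have "\<dots> \<le> 2 ^ 2"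
      using power_increasing[of "card (hits Q R h)" 2 "2::nat"] R(7) h Vc fin
      by (auto simp: card_Pow)
    finally show ?thesis by simp
  qed
  then have "card (\<Union>h\<in>V. Bad h) \<le> 4 * card V"
    using card_UN_le[OF V, of Bad] sum_bounded_above[of V "\<lambda>h. card (Bad h)" 4] by (simp add: mult.commute)
  then have "card (\<Union>h\<in>V. Bad h) < card (Pow Q)" using cardV Q by (simp add: card_Pow)
  moreover have "finite (\<Union>h\<in>V. Bad h)" using V Q by (auto simp: Bad_def)
  ultimately obtain U where U: "U \<in> Pow Q" "U \<notin> (\<Union>h\<in>V. Bad h)"
    by (metis card_mono leD subsetI)
  obtain u where u: "u \<in> X" "\<forall>q\<in>Q. u q = (if q \<in> U then \<alpha> \<one> else \<beta> \<one>)"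
    using bits[OF Q(1,2,5)] by blast
  have "\<exists>z\<in>X. (\<forall>s\<in>Q. z s = u s) \<and> (\<forall>t\<in>R. z t = \<xi> t)"
  proof (rule glue)
    show "\<forall>s\<in>Q. \<forall>k\<in>K. s \<otimes> k \<notin> R" using R(3) unfolding QK_def by fastforce
  qed (use Q R u in auto)
  then obtain z where z: "z \<in> X" "\<forall>s\<in>Q. z s = u s" "\<forall>t\<in>R. z t = \<xi> t" by blast
  \<comment> \<open>The final configuration copies \<open>y\<close> on \<open>T\<close> and at every
    image of the window under \<open>V\<close>, except within \<open>K\<close> of
    \<open>Q \<union> R\<close>.\<close>
  define Y where "Y = (T \<union> (\<lambda>(h, t). h \<otimes> t) ` (V \<times> T')) - (\<lambda>(s, k). s \<otimes> k) ` ((Q \<union> R) \<times> K)"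
  have Y: "finite Y" "Y \<subseteq> carrier G" using T V T' Vc by (auto simp: Y_def)
  have TY: "T \<subseteq> Y"
  proof
    fix t assume t: "t \<in> T"
    have "s \<otimes> k \<noteq> t" if "s \<in> Q \<union> R" "k \<in> K" for s k
      using near_T[of s k] that Q R t by blast
    then show "t \<in> Y" using t unfolding Y_def by auto
  qed
  have "\<exists>x\<in>X. (\<forall>s\<in>Q \<union> R. x s = z s) \<and> (\<forall>t\<in>Y. x t = y t)"
  proof (rule glue)
    show "\<forall>s\<in>Q \<union> R. \<forall>k\<in>K. s \<otimes> k \<notin> Y" unfolding Y_def by force
  qed (use Q R z y Y in auto)
  then obtain x where x: "x \<in> X" "\<forall>s\<in>Q \<union> R. x s = z s" "\<forall>t\<in>Y. x t = y t" by blast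
  have broken: "\<exists>t\<in>T'. h \<otimes> t \<notin> B \<and> x (h \<otimes> t) \<noteq> x t" if h: "h \<in> V - kernel_of_action" for h
  proof (cases "h \<in> E")
    case True
    then obtain t where "t \<in> R" "h \<otimes> t \<in> R" "\<xi> t \<noteq> \<xi> (h \<otimes> t)" using R(6) by blast
    then show ?thesis using x(2) z(3) R(3) T'_def by (intro bexI[of _ t]) auto
  next
    case False
    have hc: "h \<in> carrier G" using h Vc by blast
    have "U \<notin> Bad h" using U h by blast
    then obtain q where q: "q \<in> Q" "q \<notin> hits Q R h" "(q \<in> U) \<noteq> (y (h \<otimes> q) = \<alpha> \<one>)"
      using U(1) unfolding Bad_def by blast
    have qc: "q \<in> carrier G" using q Q by blast
    have nB: "h \<otimes> q \<notin> B"
    proof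
      assume b: "h \<otimes> q \<in> B"
      have "h = (h \<otimes> q) \<otimes> inv q" using hc qc by (simp add: m_assoc)
      then have "h \<in> (\<lambda>(b, q). b \<otimes> inv q) ` (B \<times> Q)" using b q(1) by force
      then show False using False h unfolding E_def by blast
    qed
    have "h \<otimes> q \<noteq> p \<otimes> k" if p: "p \<in> Q" "k \<in> K" for p k
    proof
      assume "h \<otimes> q = p \<otimes> k"
      then have "h = p \<otimes> k \<otimes> inv q" using solve_right[of h q "p \<otimes> k"] hc qc p Q Kc by auto
      then have "h \<in> (\<lambda>((p, q), k). p \<otimes> k \<otimes> inv q) ` ((Q \<times> Q) \<times> K)" using p q(1) by force
      then show False using False h unfolding E_def by blast
    qed
    then have "h \<otimes> q \<notin> (\<lambda>(s, k). s \<otimes> k) ` ((Q \<union> R) \<times> K)"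
      using q(1,2) unfolding hits_def by fastforce
    then have "h \<otimes> q \<in> Y" using h q(1) unfolding Y_def T'_def by auto
    then have "x (h \<otimes> q) = y (h \<otimes> q)" using x(3) by blast
    moreover have "x q = (if q \<in> U then \<alpha> \<one> else \<beta> \<one>)" using x(2) z(2) u(2) q(1) by auto
    ultimately have "x (h \<otimes> q) \<noteq> x q" using q(3) letters(3) by auto
    then show ?thesis using nB q(1) T'_def by blast
  qed
  show ?thesis
  proof (intro exI conjI ballI)
    fix h
    assume "h \<in> (\<lambda>(b, d, d', b'). b \<otimes> inv d \<otimes> (d' \<otimes> inv b')) `
      (B \<times> (B \<union> T') \<times> (B \<union> T') \<times> B) - kernel_of_action"
    then obtain b d d' b' where "b \<in> B" "d \<in> B \<union> T'" "d' \<in> B \<union> T'" "b' \<in> B"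
      "h = b \<otimes> inv d \<otimes> (d' \<otimes> inv b')" "h \<notin> kernel_of_action" by fast
    then have "h \<in> V - kernel_of_action"
      unfolding V_def by (intro DiffI image_eqI[of _ _ "((b, b'), (d, d'))"]) auto
    then show "\<exists>t\<in>T'. h \<otimes> t \<notin> B \<and> x (h \<otimes> t) \<noteq> x t" by (rule broken)
  next
    fix t assume "t \<in> T"
    then show "x t = y t" using x(3) TY by blast
  qed (use T' x(1) T'_def in auto)
qed

text \<open>
  A configuration \<open>y\<close> for which the number of fillings of \<open>B\<close> is minimal: a finite window of \<open>y\<close>
  excludes all other fillings, and by minimality it then admits exactly those of \<open>y\<close>.
\<close>

lemma synchronising_window:
  "\<exists>B T W y. finite B \<and> B \<subseteq> carrier G \<and> (\<forall>n\<in>kernel_of_action. \<forall>b\<in>B. n \<otimes> b \<in> B) \<and>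
    finite T \<and> T \<subseteq> carrier G \<and> T \<inter> B = {} \<and> y \<in> X \<and> finite W \<and> W \<subseteq> extensional B \<and> n \<le> card W \<and>
    (\<forall>x\<in>X. (\<forall>t\<in>T. x t = y t) \<longrightarrow>
      restrict x B \<in> W \<and> (\<forall>w\<in>W. (\<lambda>k. if k \<in> B then w k else x k) \<in> X))"
proof -
  obtain Q where Q: "finite Q" "Q \<subseteq> carrier G" "card Q = n" "separated Q"
    using separated_set[of "{}" n] by auto
  \<comment> \<open>The factor \<open>K\<close> places everything outside \<open>B\<close> at gluing
    distance from \<open>Q\<close>, so bits on \<open>Q\<close> are independent of \<open>y\<close>
    on \<open>T\<close>; the kernel factor makes \<open>B\<close> invariant.\<close>
  define B where "B = (\<lambda>(\<nu>, q, k). \<nu> \<otimes> (q \<otimes> k)) ` (kernel_of_action \<times> Q \<times> K)"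
  have B: "finite B" "B \<subseteq> carrier G"
    using finite_kernel Q K(1) Kc kernel_carrier by (auto simp: B_def subset_iff)
  have B_kernel: "\<mu> \<otimes> b \<in> B" if \<mu>: "\<mu> \<in> kernel_of_action" and b: "b \<in> B" for \<mu> b
  proof -
    obtain \<nu> q k where b: "\<nu> \<in> kernel_of_action" "q \<in> Q" "k \<in> K" "b = \<nu> \<otimes> (q \<otimes> k)"
      using b by (auto simp: B_def)
    then have "\<mu> \<otimes> b = (\<mu> \<otimes> \<nu>) \<otimes> (q \<otimes> k)" using \<mu> kernel_carrier Q Kc by (simp add: m_assoc subset_iff)
    moreover have "\<mu> \<otimes> \<nu> \<in> kernel_of_action" using subgroup.m_closed[OF subgroup_kernel \<mu> b(1)] .
    ultimately show ?thesis using b unfolding B_def by force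
  qed
  have QB: "q \<otimes> k \<in> B" if "q \<in> Q" "k \<in> K" for q k
    using that subgroup.one_closed[OF subgroup_kernel] Q Kc
    unfolding B_def by (intro image_eqI[of _ _ "(\<one>, q, k)"]) auto
  have QB': "Q \<subseteq> B" using QB[of _ \<one>] K Q by (auto simp: subset_iff)
  define fill where "fill y = {w \<in> B \<rightarrow>\<^sub>E A. (\<lambda>k. if k \<in> B then w k else y k) \<in> X}" for y :: "'a \<Rightarrow> 'b"
  have fill_fin: "finite (fill y)" for y
    using finite_PiE[OF B(1), of "\<lambda>_. A"] finite_alphabet by (simp add: fill_def)
  obtain y where y: "y \<in> X" "\<And>z. z \<in> X \<Longrightarrow> card (fill y) \<le> card (fill z)"
    using ex_has_least_nat[of "\<lambda>z. z \<in> X" \<alpha> "\<lambda>z. card (fill z)"] letters by blast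
  define ext where "ext w = (\<lambda>k. if k \<in> B then w k else y k)" for w
  define excl where "excl f F \<longleftrightarrow> finite F \<and> F \<subseteq> carrier G \<and> (\<forall>x\<in>X. \<exists>k\<in>F. x k \<noteq> f k)"
    for f :: "'a \<Rightarrow> 'b" and F
  define F where "F w = (SOME F. excl (ext w) F)" for w
  have F: "excl (ext w) (F w)" if w: "w \<in> (B \<rightarrow>\<^sub>E A) - fill y" for w
  proof -
    have "ext w \<in> extensional (carrier G)"
      using config[OF y(1)] B(2) by (auto simp: extensional_def PiE_def ext_def)
    moreover have "ext w \<notin> X" using w by (simp add: fill_def ext_def)
    ultimately have "\<exists>F. excl (ext w) F" unfolding excl_def by (rule excluded_window)
    then show ?thesis unfolding F_def by (rule someI_ex)
  qed
  define T where "T = (\<Union>w\<in>(B \<rightarrow>\<^sub>E A) - fill y. F w) - B"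
  have "finite (B \<rightarrow>\<^sub>E A)" by (rule finite_PiE[OF B(1) finite_alphabet])
  then have T: "finite T" "T \<subseteq> carrier G" "T \<inter> B = {}"
    using F by (auto simp: T_def excl_def subset_iff)
  have fill_eq: "fill z = fill y" if z: "z \<in> X" "\<forall>t\<in>T. z t = y t" for z
  proof (rule card_seteq[OF fill_fin _ y(2)[OF z(1)]])
    show "fill z \<subseteq> fill y"
    proof (rule ccontr)
      assume "\<not> ?thesis"
      then obtain w where w: "w \<in> fill z" "w \<notin> fill y" by blast
      define z' where "z' = (\<lambda>k. if k \<in> B then w k else z k)"
      have wF: "w \<in> (B \<rightarrow>\<^sub>E A) - fill y" and "z' \<in> X"
        using w by (auto simp: fill_def z'_def)
      then obtain k where k: "k \<in> F w" "z' k \<noteq> ext w k"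
        using F[OF wF] unfolding excl_def by blast
      then have "k \<notin> B" by (auto simp: z'_def ext_def)
      then have "k \<in> T" using k wF unfolding T_def by blast
      then show False using z(2) k \<open>k \<notin> B\<close> by (simp add: z'_def ext_def)
    qed
  qed
  have own: "restrict x B \<in> fill x" if "x \<in> X" for x
  proof -
    have "(\<lambda>k. if k \<in> B then restrict x B k else x k) = x" by auto
    then show ?thesis using that config[OF that] B(2) by (auto simp: fill_def)
  qed
  \<comment> \<open>Each of the \<open>2 ^ n\<close> bit patterns occurs beside \<open>y\<close> on
    \<open>T\<close>; by \<open>fill_eq\<close> the resulting contents all belong to the minimal set
    \<open>fill y\<close>.\<close>
  have "\<exists>x\<in>X. (\<forall>s\<in>Q. x s = (if s \<in> U then \<alpha> \<one> else \<beta> \<one>)) \<and> (\<forall>t\<in>T. x t = y t)" for U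
  proof -
    obtain u where u: "u \<in> X" "\<forall>q\<in>Q. u q = (if q \<in> U then \<alpha> \<one> else \<beta> \<one>)"
      using bits[OF Q(1,2,4)] by blast
    have "\<exists>x\<in>X. (\<forall>s\<in>Q. x s = u s) \<and> (\<forall>t\<in>T. x t = y t)"
      by (rule glue) (use Q T u y QB in auto)
    then show ?thesis using u by auto
  qed
  then obtain v where v: "\<And>U. v U \<in> X" "\<And>U s. s \<in> Q \<Longrightarrow> v U s = (if s \<in> U then \<alpha> \<one> else \<beta> \<one>)"
    "\<And>U t. t \<in> T \<Longrightarrow> v U t = y t" by metis
  have "inj_on (\<lambda>U. restrict (v U) B) (Pow Q)"
  proof (rule inj_onI)
    fix U U' assume U: "U \<in> Pow Q" "U' \<in> Pow Q" and eq: "restrict (v U) B = restrict (v U') B"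
    have "s \<in> U \<longleftrightarrow> s \<in> U'" if "s \<in> Q" for s
      using fun_cong[OF eq, of s] v(2)[OF that] that QB' letters(3) by (auto split: if_splits)
    then show "U = U'" using U by blast
  qed
  moreover have "(\<lambda>U. restrict (v U) B) ` Pow Q \<subseteq> fill y"
    using own fill_eq v by blast
  ultimately have *: "card (Pow Q) \<le> card (fill y)" using card_inj_on_le fill_fin by blast
  have "n \<le> 2 ^ n" by simp
  also have "\<dots> = card (Pow Q)" using Q by (simp add: card_Pow)
  finally have card_W: "n \<le> card (fill y)" using * by (rule order_trans)
  have W_ext: "fill y \<subseteq> extensional B" by (auto simp: fill_def PiE_def)
  have sync: "restrict x B \<in> fill y" "w \<in> fill y \<Longrightarrow> (\<lambda>k. if k \<in> B then w k else x k) \<in> X"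
    if "x \<in> X" "\<forall>t\<in>T. x t = y t" for x w
    using own[OF that(1)] fill_eq[OF that] unfolding fill_def by auto
  show ?thesis
    by (intro exI conjI ballI impI)
      (rule B B_kernel T y(1) fill_fin W_ext card_W sync; assumption)+
qed

end

section \<open>Assembling the embedding\<close>

context si_subshift
begin

lemma finite_group_embeds_Aut:
  fixes H :: "('h, 'n) monoid_scheme"
  assumes H: "group H" "finite (carrier H)"
  shows "\<exists>\<phi>. \<phi> \<in> mon H (Aut_subshift G A X)"
proof -
  obtain B T W y where B: "finite B" "B \<subseteq> carrier G" "\<forall>n\<in>kernel_of_action. \<forall>b\<in>B. n \<otimes> b \<in> B"
    and T: "finite T" "T \<subseteq> carrier G" "T \<inter> B = {}" and y: "y \<in> X"
    and W: "finite W" "W \<subseteq> extensional B" "card (carrier H) \<le> card W"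
    and sync: "\<forall>x\<in>X. (\<forall>t\<in>T. x t = y t) \<longrightarrow>
      restrict x B \<in> W \<and> (\<forall>w\<in>W. (\<lambda>k. if k \<in> B then w k else x k) \<in> X)"
    using synchronising_window[of "card (carrier H)"] by (elim exE conjE)
  obtain T' x where T': "finite T'" "T \<subseteq> T'" "T' \<subseteq> carrier G" "T' \<inter> B = {}" and x: "x \<in> X"
    and xT: "\<forall>t\<in>T. x t = y t"
    and broken: "\<forall>h\<in>(\<lambda>(b, d, d', b'). b \<otimes> inv d \<otimes> (d' \<otimes> inv b')) ` (B \<times> (B \<union> T') \<times> (B \<union> T') \<times> B) -
        kernel_of_action. \<exists>t\<in>T'. h \<otimes> t \<notin> B \<and> x (h \<otimes> t) \<noteq> x t"
    using isolated_occurrence[OF B(1,2) T y] by (elim exE conjE)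
  have sync': "restrict z B \<in> W \<and> (\<forall>w\<in>W. (\<lambda>k. if k \<in> B then w k else z k) \<in> X)"
    if "z \<in> X" "\<forall>t\<in>T'. z t = x t" for z
    using sync that xT T'(2) by (metis subsetD)
  interpret exchange G A X B T' x W
    by unfold_locales (use B T' sync' in auto)
  have one: "translate \<one> x = x"
    by (rule config_eqI) (use x in auto)
  have "marked x"
    unfolding marked_def
  proof (intro conjI ballI)
    fix w v assume "v \<in> V - kernel_of_action"
    then obtain t where "t \<in> T'" "v \<otimes> t \<notin> B" "x (v \<otimes> t) \<noteq> x t"
      using broken unfolding V_def by blast
    then show "\<exists>t\<in>T'. put x w (v \<otimes> t) \<noteq> x t" by (auto simp: put_def)
  qed simp
  then have "\<one> \<in> marks x" by (simp add: marks_def one)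
  moreover obtain \<iota> where "inj_on \<iota> (carrier H)" "\<iota> ` carrier H \<subseteq> W"
    using inj_on_iff_card_le[OF H(2) W(1)] W(3) by auto
  ultimately show ?thesis using finite_group_embeds[OF H(1) _ _ W(2) x] by blast
qed

end

theorem corollary4p10:
  fixes G :: "('g, 'm) monoid_scheme"
    and A :: "'a set"
    and X :: "('g \<Rightarrow> 'a) set"
    and H :: "('h, 'n) monoid_scheme"
  assumes "group G" and "infinite (carrier G)"
    and "finite A"
    and "subshift G A X"
    and "nontrivial_subshift X"
    and "strongly_irreducible G X"
    and "group H" and "finite (carrier H)"
  shows "\<exists>\<phi>. \<phi> \<in> mon H (Aut_subshift G A X)"
proof -
  interpret subshift_space G A X
    by (intro subshift_space.intro subshift_space_axioms.intro assms)
  obtain K where K: "finite K" "K \<subseteq> carrier G"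
    and irreducible: "\<forall>S T. finite S \<and> S \<subseteq> carrier G \<and> finite T \<and> T \<subseteq> carrier G \<and>
        (S <#>\<^bsub>G\<^esub> K) \<inter> T = {} \<longrightarrow>
      (\<forall>p\<in>patterns X S. \<forall>q\<in>patterns X T. \<exists>x\<in>X. restrict x S = p \<and> restrict x T = q)"
    using assms(6) unfolding strongly_irreducible_def by (elim exE conjE)
  \<comment> \<open>Enlarging \<open>K\<close> leaves fewer pairs \<open>S\<close>, \<open>T\<close>
    to be glued, so irreducibility persists; the identity makes glued sets disjoint and inverses
    make nearness symmetric.\<close>
  define K' where "K' = insert \<one>\<^bsub>G\<^esub> (K \<union> (\<lambda>k. inv\<^bsub>G\<^esub> k) ` K)"
  obtain a b where ab: "a \<in> X" "b \<in> X" "a \<noteq> b"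
    using assms(5) unfolding nontrivial_subshift_def by blast
  then obtain g where g: "g \<in> carrier G" "a g \<noteq> b g"
    using config_eqI by blast
  \<comment> \<open>Translation moves the position where \<open>a\<close> and \<open>b\<close>
    differ to the identity; the two values there serve as the bits.\<close>
  interpret si_subshift G A X K' "translate g a" "translate g b"
  proof unfold_locales
    show "infinite (carrier G)" "finite A" by fact+
    show "finite K'" "K' \<subseteq> carrier G" "\<one>\<^bsub>G\<^esub> \<in> K'" using K by (auto simp: K'_def)
    show "inv\<^bsub>G\<^esub> k \<in> K'" if "k \<in> K'" for k using that K by (auto simp: K'_def)
    show "translate g a \<in> X" "translate g b \<in> X" "translate g a \<one>\<^bsub>G\<^esub> \<noteq> translate g b \<one>\<^bsub>G\<^esub>"
      using ab g by auto
    fix S T x y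
    assume *: "finite S" "S \<subseteq> carrier G" "finite T" "T \<subseteq> carrier G"
      "\<forall>s\<in>S. \<forall>k\<in>K'. s \<otimes>\<^bsub>G\<^esub> k \<notin> T" "x \<in> X" "y \<in> X"
    have disjoint: "(S <#>\<^bsub>G\<^esub> K) \<inter> T = {}"
      using *(5) unfolding set_mult_def K'_def by blast
    have "restrict x S \<in> patterns X S" "restrict y T \<in> patterns X T"
      using *(6,7) unfolding patterns_def by (auto intro: imageI)
    with irreducible[rule_format, of S T] *(1-4) disjoint
    obtain z where z: "z \<in> X" "restrict z S = restrict x S" "restrict z T = restrict y T"
      by metis
    have "z s = x s" if "s \<in> S" for s using fun_cong[OF z(2), of s] that by simp
    moreover have "z t = y t" if "t \<in> T" for t using fun_cong[OF z(3), of t] that by simp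
    ultimately show "\<exists>z\<in>X. (\<forall>s\<in>S. z s = x s) \<and> (\<forall>t\<in>T. z t = y t)" using z(1) by blast
  qed
  show ?thesis using finite_group_embeds_Aut assms(7,8) .
qed

end
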